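(* Let $G$ be a countable linear sofic group. Then there exist a non-principal ultrafilter $\omega$ on $\mathbb{N}$, a sequence $n_k\to\infty$, a sequence $(F_k)_k$ of finite fields and an injective group morphism $\Phi:G\to\prod_{k\to\omega}GL_{n_k}(F_k)/d_\omega$. In particular, $G$ is weakly sofic.
   Context: For a field $F$ and $a,b\in M_n(F)$, $d_{rk}(a,b)=\operatorname{rk}(a-b)/n$, a bi-invariant metric on $GL_n(F)$. For fields $F_k$, $\prod_{k\to\omega}GL_{n_k}(F_k)/d_\omega$ is the quotient of $\prod_k GL_{n_k}(F_k)$ by the normal subgroup $\{(a_k)_k:\lim_{k\to\omega}d_{rk}(a_k,\mathrm{Id})=0\}$. A countable group is linear sofic if it admits an injective group morphism into $\prod_{k\to\omega}GL_{n_k}(\mathbb{C})/d_\omega$ for some non-principal ultrafilter $\omega$ and $n_k\to\infty$. A group is weakly sofic if it embeds into a metric ultraproduct $\prod_{k\to\omega}(G_k,d_k)$ of finite groups $G_k$, each equipped with a bi-invariant metric $d_k$ (the quotient of $\prod_k G_k$ by $\{(g_k)_k:\lim_{k\to\omega}d_k(g_k,e)=0\}$). *)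

theory Defs
  imports Complex_Main "HOL-Library.Countable_Set" "HOL-Algebra.Coset" "HOL-Algebra.Ring"
begin

definition ultrafilter :: "'a filter \<Rightarrow> bool" where
  "ultrafilter F \<longleftrightarrow> F \<noteq> bot \<and> (\<forall>P. eventually P F \<or> eventually (\<lambda>x. \<not> P x) F)"

definition nonprincipal_ultrafilter :: "nat filter \<Rightarrow> bool" where
  "nonprincipal_ultrafilter F \<longleftrightarrow> ultrafilter F \<and> (\<forall>n. \<not> eventually (\<lambda>k. k = n) F)"

definition mats :: "('a, 'm) ring_scheme \<Rightarrow> nat \<Rightarrow> (nat \<Rightarrow> nat \<Rightarrow> 'a) set" where
  "mats R n = {A. (\<forall>i<n. \<forall>j<n. A i j \<in> carrier R) \<and>
                  (\<forall>i j. n \<le> i \<or> n \<le> j \<longrightarrow> A i j = \<zero>\<^bsub>R\<^esub>)}"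

definition mat_mult :: "('a, 'm) ring_scheme \<Rightarrow> nat \<Rightarrow> (nat \<Rightarrow> nat \<Rightarrow> 'a) \<Rightarrow> (nat \<Rightarrow> nat \<Rightarrow> 'a) \<Rightarrow> (nat \<Rightarrow> nat \<Rightarrow> 'a)" where
  "mat_mult R n A B = (\<lambda>i j. if i < n \<and> j < n
       then (\<Oplus>\<^bsub>R\<^esub> l\<in>{..<n}. A i l \<otimes>\<^bsub>R\<^esub> B l j) else \<zero>\<^bsub>R\<^esub>)"

definition mat_one :: "('a, 'm) ring_scheme \<Rightarrow> nat \<Rightarrow> (nat \<Rightarrow> nat \<Rightarrow> 'a)" where
  "mat_one R n = (\<lambda>i j. if i < n \<and> j < n \<and> i = j then \<one>\<^bsub>R\<^esub> else \<zero>\<^bsub>R\<^esub>)"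

definition mat_minus :: "('a, 'm) ring_scheme \<Rightarrow> nat \<Rightarrow> (nat \<Rightarrow> nat \<Rightarrow> 'a) \<Rightarrow> (nat \<Rightarrow> nat \<Rightarrow> 'a) \<Rightarrow> (nat \<Rightarrow> nat \<Rightarrow> 'a)" where
  "mat_minus R n A B = (\<lambda>i j. if i < n \<and> j < n then A i j \<ominus>\<^bsub>R\<^esub> B i j else \<zero>\<^bsub>R\<^esub>)"

definition lin_indep_cols :: "('a, 'm) ring_scheme \<Rightarrow> nat \<Rightarrow> (nat \<Rightarrow> nat \<Rightarrow> 'a) \<Rightarrow> nat set \<Rightarrow> bool" where
  "lin_indep_cols R n A S \<longleftrightarrow>
     (\<forall>c. (\<forall>j\<in>S. c j \<in> carrier R) \<longrightarrow>
          (\<forall>i<n. (\<Oplus>\<^bsub>R\<^esub> j\<in>S. c j \<otimes>\<^bsub>R\<^esub> A i j) = \<zero>\<^bsub>R\<^esub>) \<longrightarrow>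
          (\<forall>j\<in>S. c j = \<zero>\<^bsub>R\<^esub>))"

definition mat_rank :: "('a, 'm) ring_scheme \<Rightarrow> nat \<Rightarrow> (nat \<Rightarrow> nat \<Rightarrow> 'a) \<Rightarrow> nat" where
  "mat_rank R n A = Max {card S | S. S \<subseteq> {..<n} \<and> lin_indep_cols R n A S}"

definition d_rk :: "('a, 'm) ring_scheme \<Rightarrow> nat \<Rightarrow> (nat \<Rightarrow> nat \<Rightarrow> 'a) \<Rightarrow> (nat \<Rightarrow> nat \<Rightarrow> 'a) \<Rightarrow> real" where
  "d_rk R n A B = real (mat_rank R n (mat_minus R n A B)) / real n"

definition GL :: "('a, 'm) ring_scheme \<Rightarrow> nat \<Rightarrow> (nat \<Rightarrow> nat \<Rightarrow> 'a) set" where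
  "GL R n = {A \<in> mats R n. \<exists>B\<in>mats R n. mat_mult R n A B = mat_one R n \<and> mat_mult R n B A = mat_one R n}"

definition GL_grp :: "('a, 'm) ring_scheme \<Rightarrow> nat \<Rightarrow> (nat \<Rightarrow> nat \<Rightarrow> 'a) monoid" where
  "GL_grp R n = \<lparr>carrier = GL R n, mult = mat_mult R n, one = mat_one R n\<rparr>"

definition complex_field :: "complex ring" where
  "complex_field = \<lparr>carrier = UNIV, mult = (*), one = 1, zero = 0, add = (+)\<rparr>"

definition prod_grp :: "(nat \<Rightarrow> ('g, 'm) monoid_scheme) \<Rightarrow> (nat \<Rightarrow> 'g) monoid" where
  "prod_grp H = \<lparr>carrier = {g. \<forall>k. g k \<in> carrier (H k)},
                 mult = (\<lambda>a b k. a k \<otimes>\<^bsub>H k\<^esub> b k),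
                 one = (\<lambda>k. \<one>\<^bsub>H k\<^esub>)\<rparr>"

definition ultra_kernel :: "nat filter \<Rightarrow> (nat \<Rightarrow> ('g, 'm) monoid_scheme) \<Rightarrow> (nat \<Rightarrow> 'g \<Rightarrow> 'g \<Rightarrow> real) \<Rightarrow> (nat \<Rightarrow> 'g) set" where
  "ultra_kernel \<omega> H d = {g \<in> carrier (prod_grp H). ((\<lambda>k. d k (g k) (\<one>\<^bsub>H k\<^esub>)) \<longlongrightarrow> 0) \<omega>}"

definition metric_ultraproduct :: "nat filter \<Rightarrow> (nat \<Rightarrow> ('g, 'm) monoid_scheme) \<Rightarrow> (nat \<Rightarrow> 'g \<Rightarrow> 'g \<Rightarrow> real) \<Rightarrow> (nat \<Rightarrow> 'g) set monoid" where
  "metric_ultraproduct \<omega> H d = prod_grp H Mod ultra_kernel \<omega> H d"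

definition linear_sofic :: "('a, 'b) monoid_scheme \<Rightarrow> bool" where
  "linear_sofic G \<longleftrightarrow>
     (\<exists>\<omega> (n :: nat \<Rightarrow> nat). nonprincipal_ultrafilter \<omega> \<and> filterlim n at_top sequentially \<and>
        (\<exists>\<Phi>. \<Phi> \<in> hom G (metric_ultraproduct \<omega> (\<lambda>k. GL_grp complex_field (n k)) (\<lambda>k. d_rk complex_field (n k)))
             \<and> inj_on \<Phi> (carrier G)))"

definition biinv_metric :: "('g, 'm) monoid_scheme \<Rightarrow> ('g \<Rightarrow> 'g \<Rightarrow> real) \<Rightarrow> bool" where
  "biinv_metric H d \<longleftrightarrow>
     (\<forall>x\<in>carrier H. \<forall>y\<in>carrier H. d x y = 0 \<longleftrightarrow> x = y) \<and>
     (\<forall>x\<in>carrier H. \<forall>y\<in>carrier H. d x y = d y x) \<and>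
     (\<forall>x\<in>carrier H. \<forall>y\<in>carrier H. \<forall>z\<in>carrier H. d x z \<le> d x y + d y z) \<and>
     (\<forall>x\<in>carrier H. \<forall>y\<in>carrier H. \<forall>z\<in>carrier H.
        d (z \<otimes>\<^bsub>H\<^esub> x) (z \<otimes>\<^bsub>H\<^esub> y) = d x y \<and> d (x \<otimes>\<^bsub>H\<^esub> z) (y \<otimes>\<^bsub>H\<^esub> z) = d x y)"

text \<open>Finite groups G_k are represented with carriers inside nat (every finite group is
  isomorphic to such a one).\<close>
definition weakly_sofic :: "('a, 'b) monoid_scheme \<Rightarrow> bool" where
  "weakly_sofic G \<longleftrightarrow>
     (\<exists>\<omega> (H :: nat \<Rightarrow> nat monoid) (d :: nat \<Rightarrow> nat \<Rightarrow> nat \<Rightarrow> real).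
        nonprincipal_ultrafilter \<omega> \<and>
        (\<forall>k. group (H k) \<and> finite (carrier (H k)) \<and> biinv_metric (H k) (d k)) \<and>
        (\<exists>\<Phi>. \<Phi> \<in> hom G (metric_ultraproduct \<omega> H d) \<and> inj_on \<Phi> (carrier G)))"

end

theory Submission
  imports Defs "HOL-Computational_Algebra.Polynomial" "HOL-Computational_Algebra.Primes"
begin

text \<open>
  A lift of the given embedding provides, for each \<open>k\<close>, complex matrices \<open>A g k\<close>. Only finitely many
  of them matter at stage \<open>k\<close>, and each rank that occurs is certified by finitely many
  complex numbers: non-trivial linear relations between columns, and left inverses of independent
  columns. A finite set of complex numbers lies in a subring \<open>R\<close> in which every non-zero element
  avoids some ideal with finite residue field; this separation property holds for the integers and
  passes from \<open>R\<close> to \<open>R[x]\<close>. Reducing modulo a suitable ideal keeps all the certificates, hence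
  all the rank distances, and the same \<open>\<omega>\<close> and \<open>n\<^sub>k\<close> work over the residue fields.
\<close>

subsection \<open>Subrings with separating finite residue fields\<close>

text \<open>There is no ring morphism from the complex numbers to a finite field, so a reduction map
  exists only on a subring that depends on the stage, and whatever is to be transported must be
  expressed by finitely many elements of that subring. The two kinds of certificate behave
  differently under such a map. A left inverse is a system of equations and survives every ring
  morphism. A linear relation stays non-trivial only if a non-zero coefficient stays non-zero; this
  is what forces the ideal to avoid prescribed elements, and several of them are handled by avoiding
  their product. Rank distances are transported exactly, not up to an error. Injectivity is
  therefore inherited without any uniform lower bound on the distances between distinct group
  elements. The passage from R to R[x] is carried out inside the ambient field: quotient rings are
  replaced by sets of representatives, division by pseudo-division, and the choice of a maximal
  ideal by counting representatives.\<close>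

locale subring_of =
  fixes R :: "'a::field set"
  assumes one_mem [simp]: "1 \<in> R"
    and diff_mem [simp]: "x \<in> R \<Longrightarrow> y \<in> R \<Longrightarrow> x - y \<in> R"
    and mult_mem [simp]: "x \<in> R \<Longrightarrow> y \<in> R \<Longrightarrow> x * y \<in> R"
begin

lemma zero_mem [simp]: "0 \<in> R"
  using diff_mem[OF one_mem one_mem] by simp

lemma uminus_mem [simp]: "x \<in> R \<Longrightarrow> - x \<in> R"
  using diff_mem[OF zero_mem] by fastforce

lemma add_mem [simp]: "x \<in> R \<Longrightarrow> y \<in> R \<Longrightarrow> x + y \<in> R"
  using diff_mem[of x "- y"] by simp

lemma power_mem [simp]: "x \<in> R \<Longrightarrow> x ^ n \<in> R"
  by (induction n) auto

lemma sum_mem: "(\<And>i. i \<in> A \<Longrightarrow> f i \<in> R) \<Longrightarrow> sum f A \<in> R"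
  by (induction A rule: infinite_finite_induct) auto

section \<open>Polynomials over the subring, adjunction of one element, pseudo-division\<close>

definition polys :: "'a poly set" where
  "polys = {f. \<forall>i. coeff f i \<in> R}"

lemma polys_simps [simp]:
  "f \<in> polys \<Longrightarrow> coeff f i \<in> R"
  "0 \<in> polys" "1 \<in> polys"
  "f \<in> polys \<Longrightarrow> g \<in> polys \<Longrightarrow> f + g \<in> polys"
  "f \<in> polys \<Longrightarrow> g \<in> polys \<Longrightarrow> f - g \<in> polys"
  "c \<in> R \<Longrightarrow> f \<in> polys \<Longrightarrow> smult c f \<in> polys"
  "c \<in> R \<Longrightarrow> monom c n \<in> polys"
  "c \<in> R \<Longrightarrow> f \<in> polys \<Longrightarrow> pCons c f \<in> polys"
  by (auto simp: polys_def coeff_pCons coeff_1 split: nat.split)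

lemma mult_polys [simp]: "f \<in> polys \<Longrightarrow> g \<in> polys \<Longrightarrow> f * g \<in> polys"
  by (auto simp: polys_def coeff_mult simp del: polys_simps(1) intro!: sum_mem)

text \<open>This is R[x] as the image of evaluation at x. An element may be represented by several
  polynomials; control over this ambiguity is the hypothesis \<open>ker\<close> of
  \<open>adjoin_separation_step\<close>.\<close>

definition adjoin :: "'a \<Rightarrow> 'a set" where
  "adjoin x = (\<lambda>f. poly f x) ` polys"

lemma adjoin_iff: "a \<in> adjoin x \<longleftrightarrow> (\<exists>f\<in>polys. a = poly f x)"
  by (auto simp: adjoin_def)

lemma subset_adjoin: "R \<subseteq> adjoin x"
proof
  fix r assume "r \<in> R"
  then show "r \<in> adjoin x"
    unfolding adjoin_iff by (intro bexI[of _ "[:r:]"]) auto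
qed

lemma gen_in_adjoin: "x \<in> adjoin x"
  unfolding adjoin_iff by (intro bexI[of _ "[:0, 1:]"]) auto

lemma subring_adjoin: "subring_of (adjoin x)"
proof
  show "1 \<in> adjoin x" using subset_adjoin[of x] by auto
  fix a b assume "a \<in> adjoin x" "b \<in> adjoin x"
  then obtain f g where fg: "f \<in> polys" "g \<in> polys" "a = poly f x" "b = poly g x"
    by (auto simp: adjoin_iff)
  show "a - b \<in> adjoin x" unfolding adjoin_iff using fg by (intro bexI[of _ "f - g"]) auto
  show "a * b \<in> adjoin x" unfolding adjoin_iff using fg by (intro bexI[of _ "f * g"]) auto
qed

text \<open>The leading coefficient of D need not be invertible in R, so f is multiplied by a power
  of it before each subtraction of a multiple of D; quotient and remainder then keep their
  coefficients in R.\<close>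

lemma pseudo_division:
  assumes "D \<in> polys" "f \<in> polys" "0 < degree D"
  shows "\<exists>m. \<exists>q\<in>polys. \<exists>r\<in>polys. smult (lead_coeff D ^ m) f = q * D + r \<and> degree r < degree D"
  using assms(2)
proof (induction "degree f" arbitrary: f rule: less_induct)
  case less
  show ?case
  proof (cases "degree f < degree D")
    case True
    then show ?thesis using less.prems by (intro exI[of _ 0] bexI[of _ 0] bexI[of _ f]) auto
  next
    case False
    define k where "k = degree f - degree D"
    define u where "u = monom (lead_coeff f) k"
    \<comment> \<open>Both terms have the same coefficient at \<open>degree f\<close>. Since
      \<open>degree f\<close> is positive, the cancellation lowers the degree even when g is
      0.\<close>
    define g where "g = smult (lead_coeff D) f - u * D"
    have u: "u \<in> polys" using less.prems by (auto simp: u_def)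
    have g: "g \<in> polys" using u less.prems assms(1) by (auto simp: g_def)
    have kd: "k + degree D = degree f" "0 < degree f" using False assms(3) by (auto simp: k_def)
    have "degree (u * D) \<le> degree f"
      using degree_mult_le[of u D] degree_monom_le[of "lead_coeff f" k] kd(1) by (simp add: u_def)
    then have "degree g \<le> degree f"
      unfolding g_def by (intro degree_diff_le) (auto simp: degree_smult_le)
    moreover have "coeff g (degree f) = 0"
      using kd(1)[symmetric] by (simp add: g_def u_def coeff_monom_mult)
    ultimately have "degree g < degree f"
      using kd(2) by (metis degree_0 le_neq_implies_less leading_coeff_0_iff)
    from less.hyps[OF this g] obtain m q r where
      h: "q \<in> polys" "r \<in> polys" "smult (lead_coeff D ^ m) g = q * D + r" "degree r < degree D" by blast
    have "smult (lead_coeff D ^ Suc m) f = (q + smult (lead_coeff D ^ m) u) * D + r"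
    proof -
      have "smult (lead_coeff D ^ Suc m) f = smult (lead_coeff D ^ m) (g + u * D)"
        by (simp add: g_def mult.commute)
      also have "\<dots> = q * D + r + smult (lead_coeff D ^ m) u * D"
        by (simp add: smult_add_right h(3))
      finally show ?thesis by (simp add: algebra_simps)
    qed
    moreover have "q + smult (lead_coeff D ^ m) u \<in> polys" using h u assms(1) by simp
    ultimately show ?thesis using h(2,4) by blast
  qed
qed

section \<open>Ideals with finite residue field\<close>

definition ideal_of :: "'a set \<Rightarrow> bool" where
  "ideal_of I \<longleftrightarrow> I \<subseteq> R \<and> 0 \<in> I \<and> (\<forall>x\<in>I. \<forall>y\<in>I. x + y \<in> I) \<and> (\<forall>r\<in>R. \<forall>x\<in>I. r * x \<in> I)"

text \<open>Finiteness of R/I without forming the quotient: T meets every residue class, possibly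
  more than once.\<close>

definition finite_index :: "'a set \<Rightarrow> bool" where
  "finite_index I \<longleftrightarrow> (\<exists>T. finite T \<and> T \<subseteq> R \<and> (\<forall>r\<in>R. \<exists>t\<in>T. r - t \<in> I))"

definition finite_residue_field :: "'a set \<Rightarrow> bool" where
  "finite_residue_field I \<longleftrightarrow> ideal_of I \<and> finite_index I \<and> 1 \<notin> I \<and>
     (\<forall>a\<in>R - I. \<exists>b\<in>R. a * b - 1 \<in> I)"

lemma ideal_ofD:
  assumes "ideal_of I"
  shows "x \<in> I \<Longrightarrow> x \<in> R" "0 \<in> I" "x \<in> I \<Longrightarrow> y \<in> I \<Longrightarrow> x + y \<in> I"
    "r \<in> R \<Longrightarrow> x \<in> I \<Longrightarrow> r * x \<in> I" "r \<in> R \<Longrightarrow> x \<in> I \<Longrightarrow> x * r \<in> I"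
    "x \<in> I \<Longrightarrow> - x \<in> I" "x \<in> I \<Longrightarrow> y \<in> I \<Longrightarrow> x - y \<in> I"
proof -
  show a: "x \<in> I \<Longrightarrow> x \<in> R" "0 \<in> I" "\<And>x y. x \<in> I \<Longrightarrow> y \<in> I \<Longrightarrow> x + y \<in> I"
    "\<And>r x. r \<in> R \<Longrightarrow> x \<in> I \<Longrightarrow> r * x \<in> I"
    using assms by (auto simp: ideal_of_def)
  show "r \<in> R \<Longrightarrow> x \<in> I \<Longrightarrow> x * r \<in> I" using a(4) by (simp add: mult.commute)
  show b: "\<And>x. x \<in> I \<Longrightarrow> - x \<in> I" using a(4)[of "-1"] by simp
  show "x \<in> I \<Longrightarrow> y \<in> I \<Longrightarrow> x - y \<in> I" using a(3)[OF _ b] by fastforce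
qed

lemma ideal_sum:
  assumes "ideal_of I" shows "(\<And>i. i \<in> A \<Longrightarrow> f i \<in> I) \<Longrightarrow> sum f A \<in> I"
  using ideal_ofD(2,3)[OF assms] by (induction A rule: infinite_finite_induct) auto

text \<open>A maximal ideal is prime: with c inverse to a modulo I, b equals
  \<open>c * (a * b) - (a * c - 1) * b\<close>, a difference of two elements of I.\<close>

lemma ideal_prime:
  assumes I: "finite_residue_field I" and "a \<in> R" "b \<in> R" "a * b \<in> I" "a \<notin> I"
  shows "b \<in> I"
proof -
  have i: "ideal_of I" using I by (simp add: finite_residue_field_def)
  obtain c where c: "c \<in> R" "a * c - 1 \<in> I" using I assms by (auto simp: finite_residue_field_def)
  have "c * (a * b) - (a * c - 1) * b \<in> I"
    using ideal_ofD(4)[OF i c(1) assms(4)] ideal_ofD(5)[OF i assms(3) c(2)] ideal_ofD(7)[OF i] by blast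
  then show ?thesis by (simp add: algebra_simps)
qed

text \<open>An ideal above J0 is determined by the representatives in T that it contains. Finite
  index thus replaces Zorn's lemma: a proper ideal above J0 that contains as many elements of T as
  possible is maximal.\<close>

lemma extend_to_finite_residue_field:
  assumes J0: "ideal_of J0" "finite_index J0" "1 \<notin> J0"
  shows "\<exists>J. J0 \<subseteq> J \<and> finite_residue_field J"
proof -
  obtain T where T: "finite T" "T \<subseteq> R" "\<And>r. r \<in> R \<Longrightarrow> \<exists>t\<in>T. r - t \<in> J0"
    using J0(2) by (auto simp: finite_index_def)
  define Q where "Q J \<longleftrightarrow> J0 \<subseteq> J \<and> ideal_of J \<and> 1 \<notin> J" for J
  have "\<exists>J. Q J \<and> (\<forall>K. Q K \<longrightarrow> card (T \<inter> K) \<le> card (T \<inter> J))"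
  proof (rule ex_has_greatest_nat)
    show "Q J0" using J0 by (simp add: Q_def)
    show "\<forall>K. Q K \<longrightarrow> card (T \<inter> K) < Suc (card T)"
      using T(1) by (auto simp: less_Suc_eq_le intro: card_mono)
  qed
  then obtain J where J: "Q J" "\<And>K. Q K \<Longrightarrow> card (T \<inter> K) \<le> card (T \<inter> J)" by blast
  have i: "ideal_of J" and sub: "J0 \<subseteq> J" and J1: "1 \<notin> J" using J(1) by (auto simp: Q_def)
  have "\<exists>b\<in>R. a * b - 1 \<in> J" if a: "a \<in> R - J" for a
  proof (rule ccontr)
    assume no: "\<not> ?thesis"
    \<comment> \<open>The ideal J + aR. It is proper exactly because a has no inverse modulo
      J.\<close>
    define K where "K = {j + a * r | j r. j \<in> J \<and> r \<in> R}"
    have JK: "J \<subseteq> K"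
    proof
      fix j assume "j \<in> J" then show "j \<in> K"
        unfolding K_def by (intro CollectI exI[of _ j] exI[of _ 0]) auto
    qed
    have aK: "a \<in> K"
      unfolding K_def using ideal_ofD(2)[OF i] by (intro CollectI exI[of _ 0] exI[of _ 1]) auto
    have "ideal_of K"
      unfolding ideal_of_def
    proof (intro conjI ballI)
      show "K \<subseteq> R" using a ideal_ofD(1)[OF i] by (auto simp: K_def)
      show "0 \<in> K" using JK ideal_ofD(2)[OF i] by auto
    next
      fix x y assume "x \<in> K" "y \<in> K"
      then obtain j r j' r' where "j \<in> J" "j' \<in> J" "r \<in> R" "r' \<in> R" "x = j + a * r" "y = j' + a * r'"
        by (auto simp: K_def)
      then show "x + y \<in> K"
        unfolding K_def using ideal_ofD(3)[OF i]
        by (intro CollectI exI[of _ "j + j'"] exI[of _ "r + r'"]) (auto simp: algebra_simps)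
    next
      fix s x assume "s \<in> R" "x \<in> K"
      then obtain j r where "j \<in> J" "r \<in> R" "x = j + a * r" by (auto simp: K_def)
      then show "s * x \<in> K"
        unfolding K_def using ideal_ofD(4)[OF i] \<open>s \<in> R\<close>
        by (intro CollectI exI[of _ "s * j"] exI[of _ "s * r"]) (simp add: distrib_left mult.left_commute)
    qed
    moreover have "1 \<notin> K"
    proof
      assume "1 \<in> K"
      then obtain j r where h: "j \<in> J" "r \<in> R" "1 = j + a * r" by (auto simp: K_def)
      then have "a * r - 1 = - j" by (simp add: algebra_simps)
      then show False using no h ideal_ofD(6)[OF i] by metis
    qed
    ultimately have "Q K" using JK sub by (auto simp: Q_def)
    \<comment> \<open>The representative t of a lies in K and not in J, as a does, because both
      ideals contain J0. So K contains more of T than J, against the choice of J.\<close>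
    moreover obtain t where t: "t \<in> T" "a - t \<in> J0" using T(3) a by blast
    have tK: "t \<in> K" using ideal_ofD(7)[OF \<open>ideal_of K\<close> aK, of "a - t"] t sub JK by auto
    have "t \<notin> J" using ideal_ofD(3)[OF i, of "a - t" t] t sub a by auto
    then have "T \<inter> J \<subset> T \<inter> K" using JK t tK by auto
    then have "card (T \<inter> J) < card (T \<inter> K)" using T(1) by (intro psubset_card_mono) auto
    ultimately show False using J(2) by fastforce
  qed
  moreover have "finite_index J" unfolding finite_index_def
    by (intro exI[of _ T]) (use T sub in \<open>meson subset_iff\<close>)
  ultimately show ?thesis using i sub J1 by (auto simp: finite_residue_field_def)
qed


section \<open>Extending an ideal of R to an ideal of R[x]\<close>

lemma mult_not_mem_ideal:
  assumes "finite_residue_field I" "a \<in> R - I" "b \<in> R - I"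
  shows "a * b \<in> R - I"
  using ideal_prime[OF assms(1), of a b] assms by auto

lemma power_not_mem_ideal:
  assumes "finite_residue_field I" "a \<in> R - I"
  shows "a ^ n \<in> R - I"
proof (induction n)
  case 0 then show ?case using assms by (simp add: finite_residue_field_def)
next
  case (Suc n) then show ?case using mult_not_mem_ideal[OF assms] by simp
qed

text \<open>Over the field R/I, a multiple of a polynomial of positive degree is never a non-zero
  constant. The degree argument is made with coefficients modulo I; it is the source of properness
  for the ideals of R[x] built next.\<close>

lemma mult_not_congruent_const:
  assumes I: "finite_residue_field I" and D: "D \<in> polys" "lead_coeff D \<notin> I" "0 < degree D"
    and w: "w \<in> polys" and s: "s \<in> R - I"
  shows "\<exists>i. coeff (w * D - [:s:]) i \<notin> I"
proof (rule ccontr)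
  assume "\<not> ?thesis"
  then have all: "coeff (w * D - [:s:]) i \<in> I" for i by blast
  have i: "ideal_of I" using I by (simp add: finite_residue_field_def)
  have wI: "coeff w k \<in> I" for k
  proof (rule ccontr)
    assume k: "coeff w k \<notin> I"
    \<comment> \<open>N is the degree of w modulo I, so modulo I the coefficient of
      \<open>w * D\<close> at \<open>N + degree D\<close> is the product of the two leading
      coefficients.\<close>
    define N where "N = Max {k. coeff w k \<notin> I}"
    have sub: "{k. coeff w k \<notin> I} \<subseteq> {..degree w}"
      using ideal_ofD(2)[OF i] by (auto, metis coeff_eq_0 not_le)
    then have fin: "finite {k. coeff w k \<notin> I}" using finite_subset by blast
    have N: "coeff w N \<notin> I" using Max_in[OF fin] k unfolding N_def by blast
    have above: "coeff w k \<in> I" if "N < k" for k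
      using Max_ge[OF fin, of k] that unfolding N_def by fastforce
    define d where "d = degree D"
    have "coeff (w * D) (N + d) = (\<Sum>k\<le>N + d. coeff w k * coeff D (N + d - k))"
      by (simp add: coeff_mult)
    also have "\<dots> = coeff w N * lead_coeff D + (\<Sum>k\<in>{..N + d} - {N}. coeff w k * coeff D (N + d - k))"
      by (subst sum.remove[of _ N]) (auto simp: d_def)
    finally have eq: "coeff w N * lead_coeff D = coeff (w * D) (N + d)
        - (\<Sum>k\<in>{..N + d} - {N}. coeff w k * coeff D (N + d - k))" by simp
    have 1: "(\<Sum>k\<in>{..N + d} - {N}. coeff w k * coeff D (N + d - k)) \<in> I"
    proof (rule ideal_sum[OF i])
      fix k assume "k \<in> {..N + d} - {N}"
      then consider "N < k" | "k < N" by fastforce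
      then show "coeff w k * coeff D (N + d - k) \<in> I"
      proof cases
        case 1 then show ?thesis using ideal_ofD(5)[OF i] above D(1) by simp
      next
        case 2 then show ?thesis using ideal_ofD(2)[OF i] by (simp add: coeff_eq_0 d_def)
      qed
    qed
    \<comment> \<open>As D has positive degree, the index \<open>N + d\<close> is positive and the
      constant s does not contribute.\<close>
    have "coeff (w * D) (N + d) = coeff (w * D - [:s:]) (N + d)"
      using D(3) by (simp add: coeff_pCons d_def split: nat.split)
    then have "coeff w N * lead_coeff D \<in> I" using eq 1 all ideal_ofD(7)[OF i] by metis
    then show False using ideal_prime[OF I, of "lead_coeff D" "coeff w N"] D N w by (simp add: mult.commute)
  qed
  have "coeff (w * D) 0 \<in> I"
    using ideal_ofD(5)[OF i _ wI[of 0], of "coeff D 0"] D(1) by (simp add: mult_poly_0_left coeff_mult)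
  moreover have "s = coeff (w * D) 0 - coeff (w * D - [:s:]) 0" by simp
  ultimately have "s \<in> I" using all ideal_ofD(7)[OF i] by metis
  then show False using s by simp
qed

text \<open>\<open>J0 I D\<close> is the ideal of R[x] generated by I and D(x). Its index is finite
  because the leading coefficient of D is invertible modulo I. It is proper because, by
  \<open>ker\<close>, every polynomial vanishing at x becomes a multiple of D after scaling by some
  s outside I. Since b has the inverse b' modulo this ideal, b lies in no proper ideal above it. The
  algebraic and the transcendental case differ only in the choice of D.\<close>

lemma adjoin_separation_step:
  fixes x :: 'a
  defines "J0 \<equiv> \<lambda>I D. {poly f x + poly q x * poly D x | f q. f \<in> polys \<and> (\<forall>i. coeff f i \<in> I) \<and> q \<in> polys}"
  assumes I: "finite_residue_field I" and D: "D \<in> polys" "lead_coeff D \<notin> I" "0 < degree D"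
    and ker: "\<And>g. g \<in> polys \<Longrightarrow> poly g x = 0 \<Longrightarrow> \<exists>s\<in>R - I. \<exists>w\<in>polys. smult s g = w * D"
    and b: "b \<in> adjoin x" "b' \<in> adjoin x" "b * b' - 1 \<in> J0 I D"
  shows "\<exists>J. subring_of.finite_residue_field (adjoin x) J \<and> b \<notin> J"
proof -
  interpret A: subring_of "adjoin x" by (rule subring_adjoin)
  have i: "ideal_of I" and fin: "finite_index I" using I by (auto simp: finite_residue_field_def)
  define J where "J = J0 I D"
  have JI: "poly f x + poly q x * poly D x \<in> J" if "f \<in> polys" "\<And>i. coeff f i \<in> I" "q \<in> polys" for f q
    using that unfolding J_def J0_def by blast
  have idJ: "A.ideal_of J"
    unfolding A.ideal_of_def
  proof (intro conjI ballI)
    show "J \<subseteq> adjoin x"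
    proof
      fix a assume "a \<in> J"
      then obtain f q where "f \<in> polys" "q \<in> polys" "a = poly f x + poly q x * poly D x"
        by (auto simp: J_def J0_def)
      then show "a \<in> adjoin x"
        unfolding adjoin_iff using D(1) by (intro bexI[of _ "f + q * D"]) auto
    qed
    show "0 \<in> J" using JI[of 0 0] ideal_ofD(2)[OF i] by simp
  next
    fix a c assume "a \<in> J" "c \<in> J"
    then obtain f q f' q' where h: "f \<in> polys" "q \<in> polys" "a = poly f x + poly q x * poly D x"
      "f' \<in> polys" "q' \<in> polys" "c = poly f' x + poly q' x * poly D x"
      "\<And>i. coeff f i \<in> I" "\<And>i. coeff f' i \<in> I"
      unfolding J_def J0_def by blast
    then have "poly (f + f') x + poly (q + q') x * poly D x \<in> J"
      by (intro JI) (auto intro: ideal_ofD(3)[OF i])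
    then show "a + c \<in> J" by (simp add: h algebra_simps)
  next
    fix r a assume "r \<in> adjoin x" "a \<in> J"
    then obtain g f q where h: "g \<in> polys" "r = poly g x" "f \<in> polys" "q \<in> polys"
      "a = poly f x + poly q x * poly D x" "\<And>i. coeff f i \<in> I"
      unfolding J_def J0_def adjoin_iff by blast
    then have "poly (g * f) x + poly (g * q) x * poly D x \<in> J"
      by (intro JI) (auto simp: coeff_mult intro!: ideal_sum[OF i] ideal_ofD(4)[OF i])
    then show "r * a \<in> J" by (simp add: h algebra_simps)
  qed
  note Jd = A.ideal_ofD[OF idJ]
  have IJ: "a \<in> J" if "a \<in> I" for a
    using JI[of "[:a:]" 0] that ideal_ofD(1,2)[OF i] by (auto simp: coeff_pCons split: nat.split)
  have DJ: "poly D x \<in> J" using JI[of 0 1] ideal_ofD(2)[OF i] by simp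
  \<comment> \<open>If 1 = f(x) + q(x) D(x), then \<open>f + q * D - 1\<close> vanishes at x, so s
    times it is \<open>w * D\<close>. Modulo I this makes the multiple
    \<open>(smult s q - w) * D\<close> of D equal to the constant s, which is impossible.\<close>
  have 1: "1 \<notin> J"
  proof
    assume "1 \<in> J"
    then obtain f q where h: "f \<in> polys" "q \<in> polys" "1 = poly f x + poly q x * poly D x" "\<And>i. coeff f i \<in> I"
      unfolding J_def J0_def by blast
    then obtain s w where sw: "s \<in> R - I" "w \<in> polys" "smult s (f + q * D - 1) = w * D"
      using ker[of "f + q * D - 1"] D(1) by auto
    then have "(smult s q - w) * D - [:s:] = - smult s f"
      by (simp add: algebra_simps smult_diff_right smult_add_right one_pCons)
    moreover have "coeff (- smult s f) i \<in> I" for i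
      using h sw ideal_ofD(4,6)[OF i] by simp
    ultimately show False
      using mult_not_congruent_const[OF I D, of "smult s q - w" s] sw h by auto
  qed
  obtain T where T: "finite T" "T \<subseteq> R" "\<And>r. r \<in> R \<Longrightarrow> \<exists>t\<in>T. r - t \<in> I"
    using fin by (auto simp: finite_index_def)
  \<comment> \<open>Modulo D(x) only degrees below \<open>degree D\<close> occur, and modulo I each
    coefficient can be taken from T.\<close>
  define S where "S = (\<lambda>t. \<Sum>k<degree D. t k * x ^ k) ` (PiE {..<degree D} (\<lambda>_. T))"
  have xA: "x ^ k \<in> adjoin x" for k using gen_in_adjoin by simp
  have "A.finite_index J"
    unfolding A.finite_index_def
  proof (intro exI[of _ S] conjI ballI)
    show "finite S" unfolding S_def using T(1) by (intro finite_imageI finite_PiE) auto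
    show "S \<subseteq> adjoin x"
      unfolding S_def using T(2) subset_adjoin[of x] xA by (force intro!: A.sum_mem A.mult_mem)
  next
    fix a assume "a \<in> adjoin x"
    then obtain f where f: "f \<in> polys" "a = poly f x" by (auto simp: adjoin_iff)
    obtain m q r where h: "q \<in> polys" "r \<in> polys" "smult (lead_coeff D ^ m) f = q * D + r" "degree r < degree D"
      using pseudo_division[OF D(1) f(1) D(3)] by blast
    have "lead_coeff D ^ m \<in> R - I" using power_not_mem_ideal[OF I] D by simp
    \<comment> \<open>Pseudo-division describes only a power of the leading coefficient times a;
      multiplying by u undoes that factor modulo I.\<close>
    then obtain u where u: "u \<in> R" "lead_coeff D ^ m * u - 1 \<in> I"
      using I by (auto simp: finite_residue_field_def)
    have "lead_coeff D ^ m * a = poly q x * poly D x + poly r x"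
      using arg_cong[OF h(3), of "\<lambda>f. poly f x"] f by simp
    from arg_cong[OF this, of "(*) u"]
    have "a - u * poly r x = (u * poly q x) * poly D x - a * (lead_coeff D ^ m * u - 1)"
      by (simp add: algebra_simps)
    moreover have "(u * poly q x) * poly D x \<in> J"
      using DJ u h subset_adjoin[of x] adjoin_iff by (intro Jd(4) A.mult_mem) blast+
    moreover have "a * (lead_coeff D ^ m * u - 1) \<in> J"
      using IJ[OF u(2)] \<open>a \<in> adjoin x\<close> by (intro Jd(4))
    ultimately have 1: "a - u * poly r x \<in> J" using Jd(7) by metis
    have "\<exists>t\<in>T. u * coeff r k - t \<in> I" for k using T(3) u(1) h(2) by simp
    then obtain t where t: "\<And>k. t k \<in> T" "\<And>k. u * coeff r k - t k \<in> I" by metis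
    define y where "y = (\<Sum>k<degree D. t k * x ^ k)"
    have "y \<in> S" unfolding S_def y_def
      by (rule image_eqI[of _ _ "restrict t {..<degree D}"]) (auto simp: t)
    moreover have "poly r x = (\<Sum>k<degree D. coeff r k * x ^ k)"
      unfolding poly_altdef using h(4) by (intro sum.mono_neutral_left) (auto simp: coeff_eq_0)
    then have "u * poly r x - y = (\<Sum>k<degree D. (u * coeff r k - t k) * x ^ k)"
      by (simp add: y_def sum_distrib_left sum_subtractf left_diff_distrib mult.assoc)
    then have "u * poly r x - y \<in> J"
      using IJ[OF t(2)] xA by (auto intro!: A.ideal_sum[OF idJ] Jd(5))
    from Jd(3)[OF 1 this] have "a - y \<in> J" by simp
    ultimately show "\<exists>y\<in>S. a - y \<in> J" by blast
  qed
  from A.extend_to_finite_residue_field[OF idJ this 1] obtain M where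
    M: "J \<subseteq> M" "A.finite_residue_field M" by blast
  have "b \<notin> M"
  proof
    assume "b \<in> M"
    have m: "A.ideal_of M" using M(2) by (simp add: A.finite_residue_field_def)
    have "b * b' - (b * b' - 1) \<in> M"
      using A.ideal_ofD(5)[OF m b(2) \<open>b \<in> M\<close>] A.ideal_ofD(7)[OF m] M(1) b(3) J_def by blast
    then show False using M(2) by (simp add: A.finite_residue_field_def)
  qed
  then show ?thesis using M(2) by blast
qed


text \<open>The ideals with finite residue field intersect in 0. The existence of one such ideal
  would be too weak for the induction over adjunctions, in which the ideal of R must avoid elements
  such as leading coefficients that depend on the element of R[x] under consideration.\<close>

definition separated :: bool where
  "separated \<longleftrightarrow> (\<forall>b\<in>R. b \<noteq> 0 \<longrightarrow> (\<exists>I. finite_residue_field I \<and> b \<notin> I))"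

text \<open>With b = B(x), the choice D = 1 + X B makes b invertible modulo D(x), with inverse -x. D
  has the leading coefficient of B, which I is chosen to avoid, and the kernel of evaluation is
  trivial.\<close>

lemma separated_adjoin_transcendental:
  assumes sep: separated and x: "\<And>f. f \<in> polys \<Longrightarrow> poly f x = 0 \<Longrightarrow> f = 0"
  shows "subring_of.separated (adjoin x)"
proof -
  interpret A: subring_of "adjoin x" by (rule subring_adjoin)
  show ?thesis
    unfolding A.separated_def
  proof (intro ballI impI)
    fix b assume b: "b \<in> adjoin x" "b \<noteq> 0"
    then obtain B where B: "B \<in> polys" "b = poly B x" by (auto simp: adjoin_iff)
    have B0: "B \<noteq> 0" using B b by auto
    obtain I where I: "finite_residue_field I" "lead_coeff B \<notin> I"
      using sep B B0 unfolding separated_def by (metis leading_coeff_neq_0 polys_simps(1))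
    have i: "ideal_of I" using I by (simp add: finite_residue_field_def)
    show "\<exists>J. A.finite_residue_field J \<and> b \<notin> J"
    proof (rule adjoin_separation_step[OF I(1), of "pCons 1 B" x b "- x"])
      show "lead_coeff (pCons 1 B) \<notin> I" "0 < degree (pCons 1 B)" using I B0 by auto
      show "\<exists>s\<in>R - I. \<exists>w\<in>polys. smult s g = w * pCons 1 B" if "g \<in> polys" "poly g x = 0" for g
        using x[OF that] I(1) by (intro bexI[of _ 1] bexI[of _ 0]) (auto simp: finite_residue_field_def)
      show "b * - x - 1 \<in> {poly f x + poly q x * poly (pCons 1 B) x |f q.
          f \<in> polys \<and> (\<forall>i. coeff f i \<in> I) \<and> q \<in> polys}"
      proof -
        have "b * - x - 1 = poly 0 x + poly (0 - 1) x * poly (pCons 1 B) x"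
          using B by (simp add: algebra_simps)
        moreover have "0 - 1 \<in> polys" "\<forall>i. coeff 0 i \<in> I" using ideal_ofD(2)[OF i] by (simp_all only: polys_simps coeff_0 simp_thms)
        ultimately show ?thesis using polys_simps(2) by blast
      qed
    qed (use B b gen_in_adjoin in auto)
  qed
qed

text \<open>Here D is a polynomial p of least degree vanishing at x. A non-zero b has a non-zero
  multiple r in R, which plays the part of a norm; an ideal of R that avoids r makes r, and hence b,
  invertible in the quotient.\<close>

lemma separated_adjoin_algebraic:
  assumes sep: separated and x: "f0 \<in> polys" "poly f0 x = 0" "f0 \<noteq> 0"
  shows "subring_of.separated (adjoin x)"
proof -
  interpret A: subring_of "adjoin x" by (rule subring_adjoin)
  define P where "P f \<longleftrightarrow> f \<in> polys \<and> poly f x = 0 \<and> f \<noteq> 0" for f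
  obtain p where "P p" and min: "\<And>f. P f \<Longrightarrow> degree p \<le> degree f"
    using ex_has_least_nat[of P f0 degree] x by (auto simp: P_def)
  then have p: "p \<in> polys" "poly p x = 0" "p \<noteq> 0" by (auto simp: P_def)
  have small: "f = 0" if "f \<in> polys" "poly f x = 0" "degree f < degree p" for f
    using min[of f] that by (auto simp: P_def)
  have dp: "0 < degree p"
  proof (rule ccontr)
    assume "\<not> ?thesis"
    then obtain c where "p = [:c:]" by (auto elim: degree_eq_zeroE)
    then show False using p by simp
  qed
  show ?thesis
    unfolding A.separated_def
  proof (intro ballI impI)
    fix b assume b: "b \<in> adjoin x" "b \<noteq> 0"
    \<comment> \<open>The polynomials that represent non-zero multiples of b. One of least degree
      turns out to be constant, and this constant is r.\<close>
    define Q where "Q C \<longleftrightarrow> C \<in> polys \<and> poly C x \<noteq> 0 \<and> (\<exists>c\<in>adjoin x. poly C x = c * b)" for C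
    obtain B where B: "B \<in> polys" "b = poly B x" using b by (auto simp: adjoin_iff)
    have "Q B" unfolding Q_def using B b by (auto intro!: bexI[of _ 1])
    then obtain C where "Q C" and Cmin: "\<And>f. Q f \<Longrightarrow> degree C \<le> degree f"
      using ex_has_least_nat[of Q B degree] by blast
    then obtain c where C: "C \<in> polys" "poly C x \<noteq> 0" "c \<in> adjoin x" "poly C x = c * b"
      by (auto simp: Q_def)
    \<comment> \<open>Otherwise the pseudo-remainder of C by p would represent a non-zero multiple
      of b in smaller degree.\<close>
    have degC: "degree C < degree p"
    proof (rule ccontr)
      assume n: "\<not> ?thesis"
      obtain m q r where h: "q \<in> polys" "r \<in> polys" "smult (lead_coeff p ^ m) C = q * p + r" "degree r < degree p"
        using pseudo_division[OF p(1) C(1) dp] by blast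
      have "poly r x = lead_coeff p ^ m * poly C x"
        using arg_cong[OF h(3), of "\<lambda>f. poly f x"] p by simp
      then have "Q r" unfolding Q_def using h C p subset_adjoin[of x]
        by (auto intro!: bexI[of _ "lead_coeff p ^ m * c"] A.mult_mem A.power_mem)
      then show False using Cmin[of r] h n by simp
    qed
    \<comment> \<open>Otherwise pseudo-divide p by C. The remainder represents a multiple of b, so
      by minimality of C it vanishes at x, and by minimality of p it is 0. Then \<open>q * C\<close>
      is a non-zero scalar multiple of p, so q vanishes at x although its degree is below that of p
      and q is not 0.\<close>
    have "degree C = 0"
    proof (rule ccontr)
      assume n: "degree C \<noteq> 0"
      obtain m q r where h: "q \<in> polys" "r \<in> polys" "smult (lead_coeff C ^ m) p = q * C + r" "degree r < degree C"
        using pseudo_division[OF C(1) p(1)] n by blast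
      have rq: "poly r x = - poly q x * poly C x"
        using arg_cong[OF h(3), of "\<lambda>f. poly f x"] p by (simp add: eq_neg_iff_add_eq_0 add.commute)
      have qA: "poly q x \<in> adjoin x" using h by (auto simp: adjoin_iff)
      have r0: "poly r x = 0"
      proof (rule ccontr)
        assume "poly r x \<noteq> 0"
        then have "Q r" unfolding Q_def using h C rq qA
          by (auto intro!: bexI[of _ "- poly q x * c"] A.mult_mem A.uminus_mem)
        then show False using Cmin[of r] h by simp
      qed
      then have "r = 0" using small[of r] h degC by simp
      moreover have "C \<noteq> 0" using n by auto
      ultimately have eq: "q * C = smult (lead_coeff C ^ m) p" "q \<noteq> 0" using h p by auto
      then have "degree q + degree C = degree p"
        using \<open>C \<noteq> 0\<close> by (metis degree_mult_eq degree_smult_eq leading_coeff_neq_0 power_not_zero)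
      then have "q = 0" using small[of q] h r0 rq C n by simp
      then show False using eq by simp
    qed
    then obtain r where r: "C = [:r:]" by (auto elim: degree_eq_zeroE)
    have rR: "r \<in> R" "r \<noteq> 0" "r = c * b" using C r polys_simps(1)[OF C(1), of 0] by auto
    \<comment> \<open>Avoiding the product avoids both r, for the invertibility of b, and the
      leading coefficient of p, for finite index and for \<open>ker\<close>.\<close>
    have "r * lead_coeff p \<in> R" "r * lead_coeff p \<noteq> 0" using rR p by auto
    then obtain I where I: "finite_residue_field I" "r * lead_coeff p \<notin> I"
      using sep unfolding separated_def by blast
    have i: "ideal_of I" using I by (simp add: finite_residue_field_def)
    have rI: "r \<notin> I" "lead_coeff p \<notin> I" using I rR p ideal_ofD(4,5)[OF i] by auto
    then obtain r' where r': "r' \<in> R" "r * r' - 1 \<in> I"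
      using I rR by (auto simp: finite_residue_field_def)
    show "\<exists>J. A.finite_residue_field J \<and> b \<notin> J"
    proof (rule adjoin_separation_step[OF I(1) p(1) rI(2) dp, of x b "c * r'"])
      show "\<exists>s\<in>R - I. \<exists>w\<in>polys. smult s g = w * p" if g: "g \<in> polys" "poly g x = 0" for g
      proof -
        \<comment> \<open>The pseudo-remainder vanishes at x in degree below
          \<open>degree p\<close>, so it is 0; the scalar s is a power of the leading
          coefficient.\<close>
        obtain m q t where h: "q \<in> polys" "t \<in> polys" "smult (lead_coeff p ^ m) g = q * p + t" "degree t < degree p"
          using pseudo_division[OF p(1) g(1) dp] by blast
        have "poly t x = 0"
          using arg_cong[OF h(3), of "\<lambda>f. poly f x"] p g by simp
        then have "t = 0" using small h by blast
        then show ?thesis using h power_not_mem_ideal[OF I(1), of "lead_coeff p" m] rI p by auto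
      qed
      show "c * r' \<in> adjoin x" using C r' subset_adjoin[of x] by (auto intro!: A.mult_mem)
      have "b * (c * r') - 1 = r * r' - 1" using rR by simp
      then show "b * (c * r') - 1 \<in> {poly f x + poly q x * poly p x |f q.
          f \<in> polys \<and> (\<forall>i. coeff f i \<in> I) \<and> q \<in> polys}"
        using ideal_ofD(2)[OF i] r' rR
        by (intro CollectI exI[of _ "[:r * r' - 1:]"] exI[of _ 0]) (auto simp: coeff_pCons split: nat.split)
    qed (use b in auto)
  qed
qed

lemma separated_adjoin: "separated \<Longrightarrow> subring_of.separated (adjoin x)"
  using separated_adjoin_algebraic separated_adjoin_transcendental by blast

end

section \<open>The integers, finite sets of numbers, and their reduction maps\<close>

lemma subring_Ints: "subring_of (\<int> :: 'a::field_char_0 set)"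
  by standard auto

lemma separated_Ints: "subring_of.separated (\<int> :: 'a::field_char_0 set)"
proof -
  interpret subring_of "\<int> :: 'a set" by (rule subring_Ints)
  show ?thesis
    unfolding separated_def
  proof (intro ballI impI)
    fix b :: 'a assume "b \<in> \<int>" "b \<noteq> 0"
    then obtain n :: int where n: "b = of_int n" "n \<noteq> 0" by (auto elim: Ints_cases)
    \<comment> \<open>A prime larger than the absolute value of the non-zero n does not divide n, so
      the ideal of its multiples avoids b.\<close>
    obtain q :: nat where q: "prime q" "q > nat \<bar>n\<bar>" using bigger_prime by blast
    define p where "p = int q"
    have p: "prime p" "p > \<bar>n\<bar>" using q by (auto simp: p_def)
    define I :: "'a set" where "I = {of_int (p * k) | k. True}"
    have mem: "(of_int m :: 'a) \<in> I \<longleftrightarrow> p dvd m" for m by (auto simp: I_def dvd_def simp del: of_int_mult)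
    have "ideal_of I"
      unfolding ideal_of_def
    proof (intro conjI ballI)
      show "I \<subseteq> \<int>" by (auto simp: I_def)
      show "0 \<in> I" using mem[of 0] by simp
    next
      fix x y :: 'a assume "x \<in> I" "y \<in> I"
      then show "x + y \<in> I" using mem by (auto simp: I_def simp flip: distrib_left of_int_add of_int_mult)
    next
      fix r x :: 'a assume "r \<in> \<int>" "x \<in> I"
      then obtain m k where "r = of_int m" "x = of_int (p * k)" unfolding I_def by (blast elim: Ints_cases)
      then show "r * x \<in> I" using mem[of "m * (p * k)"] by simp
    qed
    moreover have "finite_index I"
      unfolding finite_index_def
    proof (intro exI[of _ "of_int ` {0..<p}"] conjI ballI)
      fix r :: 'a assume "r \<in> \<int>"
      then obtain m where m: "r = of_int m" by (auto elim: Ints_cases)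
      have "(of_int (m - m mod p) :: 'a) \<in> I" unfolding mem by (simp add: minus_mod_eq_mult_div)
      then show "\<exists>t\<in>of_int ` {0..<p}. r - t \<in> I"
        using p by (intro bexI[of _ "of_int (m mod p)"]) (auto simp: m)
    qed auto
    moreover have "1 \<notin> I" using mem[of 1] p by (auto simp: prime_int_iff)
    moreover have "\<exists>c\<in>\<int>. a * c - 1 \<in> I" if a: "a \<in> \<int> - I" for a
    proof -
      obtain m where m: "a = of_int m" "\<not> p dvd m" using a mem by (auto elim: Ints_cases)
      then have "coprime m p" using p prime_imp_coprime coprime_commute by blast
      then obtain u v where "m * u + p * v = 1"
        using bezout_int[of m p] by (auto simp: mult.commute)
      then have "m * u - 1 = p * (- v)" by (simp add: algebra_simps)
      then have "(of_int (m * u - 1) :: 'a) \<in> I" unfolding mem by (metis dvd_triv_left)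
      then show ?thesis by (intro bexI[of _ "of_int u"]) (auto simp: m)
    qed
    ultimately have "finite_residue_field I" by (simp add: finite_residue_field_def)
    moreover have "b \<notin> I"
      unfolding n mem using p n dvd_imp_le_int[of n p] prime_ge_0_int[of p] by auto
    ultimately show "\<exists>I. finite_residue_field I \<and> b \<notin> I" by blast
  qed
qed

text \<open>Characteristic zero embeds the integers as a starting point, and each element of X costs
  one adjunction.\<close>

lemma finite_subset_separated:
  fixes X :: "'a::field_char_0 set"
  assumes "finite X"
  shows "\<exists>R. X \<subseteq> R \<and> subring_of R \<and> subring_of.separated R"
  using assms
proof (induction X)
  case empty
  then show ?case using subring_Ints separated_Ints by blast
next
  case (insert x X)
  then obtain R where R: "X \<subseteq> R" "subring_of R" "subring_of.separated R" by blast
  interpret subring_of R by (rule R(2))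
  show ?case
    using R subset_adjoin[of x] gen_in_adjoin[of x] subring_adjoin[of x] separated_adjoin[of x]
    by (intro exI[of _ "adjoin x"]) auto
qed

text \<open>\<open>\<phi>\<close> is a total function that behaves as a ring morphism on R only. X
  lists the numbers under control: they lie in R, and the non-zero ones stay non-zero. The field
  lives on \<open>nat\<close> so that the fields of all stages have the same type.\<close>

definition reduction :: "'a::field set \<Rightarrow> 'a set \<Rightarrow> nat ring \<Rightarrow> ('a \<Rightarrow> nat) \<Rightarrow> bool" where
  "reduction X R F \<phi> \<longleftrightarrow> X \<subseteq> R \<and> subring_of R \<and> field F \<and> finite (carrier F) \<and>
     \<phi> ` R \<subseteq> carrier F \<and> \<phi> 0 = \<zero>\<^bsub>F\<^esub> \<and> \<phi> 1 = \<one>\<^bsub>F\<^esub> \<and>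
     (\<forall>x\<in>R. \<forall>y\<in>R. \<phi> (x + y) = \<phi> x \<oplus>\<^bsub>F\<^esub> \<phi> y \<and> \<phi> (x * y) = \<phi> x \<otimes>\<^bsub>F\<^esub> \<phi> y) \<and>
     (\<forall>x\<in>X. x \<noteq> 0 \<longrightarrow> \<phi> x \<noteq> \<zero>\<^bsub>F\<^esub>)"

text \<open>This is the projection of R onto R/I, with the finitely many residue classes numbered so
  that the quotient has its carrier in \<open>nat\<close>.\<close>

lemma (in subring_of) residue_class_map:
  assumes I: "finite_residue_field I"
  shows "\<exists>(F :: nat ring) \<phi>. field F \<and> finite (carrier F) \<and>
     \<phi> ` R \<subseteq> carrier F \<and> \<phi> 0 = \<zero>\<^bsub>F\<^esub> \<and> \<phi> 1 = \<one>\<^bsub>F\<^esub> \<and>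
     (\<forall>x\<in>R. \<forall>y\<in>R. \<phi> (x + y) = \<phi> x \<oplus>\<^bsub>F\<^esub> \<phi> y \<and> \<phi> (x * y) = \<phi> x \<otimes>\<^bsub>F\<^esub> \<phi> y) \<and>
     (\<forall>x\<in>R. \<phi> x = \<zero>\<^bsub>F\<^esub> \<longrightarrow> x \<in> I)"
proof -
  have i: "ideal_of I" and inv: "\<forall>a\<in>R - I. \<exists>b\<in>R. a * b - 1 \<in> I" and 1: "1 \<notin> I"
    using I by (auto simp: finite_residue_field_def)
  note id = ideal_ofD[OF i]
  obtain T where T: "finite T" "T \<subseteq> R" "\<And>r. r \<in> R \<Longrightarrow> \<exists>t\<in>T. r - t \<in> I"
    using I by (auto simp: finite_residue_field_def finite_index_def)
  define cls where "cls r = {y\<in>R. y - r \<in> I}" for r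
  have cls_eq: "cls r = cls s \<longleftrightarrow> r - s \<in> I" if "r \<in> R" "s \<in> R" for r s
  proof
    assume "cls r = cls s"
    moreover have "r \<in> cls r" using that id(2) by (simp add: cls_def)
    ultimately show "r - s \<in> I" by (auto simp: cls_def)
  next
    assume rs: "r - s \<in> I"
    have "y - r \<in> I \<longleftrightarrow> y - s \<in> I" for y
      using id(3)[OF _ rs, of "y - r"] id(7)[OF _ rs, of "y - s"] by auto
    then show "cls r = cls s" by (simp add: cls_def)
  qed
  have "cls ` R \<subseteq> cls ` T"
  proof
    fix c assume "c \<in> cls ` R"
    then obtain r where r: "r \<in> R" "c = cls r" by blast
    then obtain t where "t \<in> T" "r - t \<in> I" using T(3) by blast
    then show "c \<in> cls ` T" using cls_eq[of r t] r T(2) by blast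
  qed
  then have fin: "finite (cls ` R)" using T(1) finite_surj by blast
  define \<phi> where "\<phi> r = to_nat_on (cls ` R) (cls r)" for r
  have \<phi>_eq: "\<phi> r = \<phi> s \<longleftrightarrow> r - s \<in> I" if "r \<in> R" "s \<in> R" for r s
    using that cls_eq[OF that] fin by (simp add: \<phi>_def countable_finite)
  \<comment> \<open>The operations of F are computed on representatives chosen by g;
    \<open>gI\<close> gives their independence of this choice.\<close>
  define g where "g = inv_into R \<phi>"
  have gR: "g a \<in> R" and \<phi>g: "\<phi> (g a) = a" if "a \<in> \<phi> ` R" for a
    using that by (auto simp: g_def inv_into_into f_inv_into_f)
  have gI: "g (\<phi> x) - x \<in> I" if "x \<in> R" for x
    using \<phi>_eq[of "g (\<phi> x)" x] gR \<phi>g that by auto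
  define F :: "nat ring" where "F = \<lparr>carrier = \<phi> ` R, monoid.mult = (\<lambda>a b. \<phi> (g a * g b)), one = \<phi> 1,
    zero = \<phi> 0, add = (\<lambda>a b. \<phi> (g a + g b))\<rparr>"
  have add: "\<phi> x \<oplus>\<^bsub>F\<^esub> \<phi> y = \<phi> (x + y)" if "x \<in> R" "y \<in> R" for x y
  proof -
    have "g (\<phi> x) + g (\<phi> y) - (x + y) = (g (\<phi> x) - x) + (g (\<phi> y) - y)" by simp
    also have "\<dots> \<in> I" using gI that id(3) by simp
    finally show ?thesis using \<phi>_eq gR that by (simp add: F_def)
  qed
  have mult: "\<phi> x \<otimes>\<^bsub>F\<^esub> \<phi> y = \<phi> (x * y)" if "x \<in> R" "y \<in> R" for x y
  proof -
    have "g (\<phi> x) * g (\<phi> y) - x * y = g (\<phi> x) * (g (\<phi> y) - y) + y * (g (\<phi> x) - x)"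
      by (simp add: algebra_simps)
    also have "\<dots> \<in> I" using gI gR that id(3,4) by simp
    finally show ?thesis using \<phi>_eq gR that by (simp add: F_def)
  qed
  have car: "carrier F = \<phi> ` R" and zero: "\<zero>\<^bsub>F\<^esub> = \<phi> 0" and one: "\<one>\<^bsub>F\<^esub> = \<phi> 1"
    by (simp_all add: F_def)
  have "abelian_group F"
  proof (rule abelian_groupI)
    fix x assume "x \<in> carrier F"
    then obtain r where "r \<in> R" "x = \<phi> r" by (auto simp: car)
    then show "\<exists>y\<in>carrier F. y \<oplus>\<^bsub>F\<^esub> x = \<zero>\<^bsub>F\<^esub>"
      by (intro bexI[of _ "\<phi> (- r)"]) (auto simp: car add zero)
  qed (auto simp: car add zero add.commute add.left_commute add.assoc)
  moreover have "Group.comm_monoid F"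
    by (rule Group.comm_monoidI) (auto simp: car mult one mult.commute mult.left_commute mult.assoc)
  ultimately have "cring F"
    by (rule cringI) (auto simp: car mult add distrib_right)
  then interpret cring F .
  have "field F"
  proof (rule cring_fieldI)
    have "x \<in> Units F" if x: "x \<in> carrier F" "x \<noteq> \<zero>\<^bsub>F\<^esub>" for x
    proof -
      obtain r where r: "r \<in> R" "x = \<phi> r" using x by (auto simp: car)
      then have "r \<in> R - I" using x \<phi>_eq[of r 0] by (simp add: zero)
      then obtain s where s: "s \<in> R" "r * s - 1 \<in> I" using inv by blast
      have "x \<otimes>\<^bsub>F\<^esub> \<phi> s = \<one>\<^bsub>F\<^esub>" using r s \<phi>_eq by (simp add: mult one)
      moreover have "\<phi> s \<in> carrier F" using s by (simp add: car)
      ultimately show ?thesis using x(1) m_comm unfolding Units_def by force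
    qed
    moreover have "\<zero>\<^bsub>F\<^esub> \<notin> Units F"
    proof
      assume "\<zero>\<^bsub>F\<^esub> \<in> Units F"
      then have "\<one>\<^bsub>F\<^esub> = \<zero>\<^bsub>F\<^esub>" by (metis Units_closed Units_r_inv Units_inv_closed l_null)
      then show False using 1 \<phi>_eq[of 1 0] by (simp add: one zero)
    qed
    ultimately show "Units F = carrier F - {\<zero>\<^bsub>F\<^esub>}" using Units_closed by auto
  qed
  moreover have "finite (carrier F)" unfolding car \<phi>_def using fin
    by (simp add: image_image[symmetric, of "to_nat_on (cls ` R)" cls])
  moreover have "\<forall>x\<in>R. \<phi> x = \<zero>\<^bsub>F\<^esub> \<longrightarrow> x \<in> I" using \<phi>_eq[of _ 0] by (simp add: zero)
  moreover have "\<phi> ` R \<subseteq> carrier F" "\<phi> 0 = \<zero>\<^bsub>F\<^esub>" "\<phi> 1 = \<one>\<^bsub>F\<^esub>"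
    "\<forall>x\<in>R. \<forall>y\<in>R. \<phi> (x + y) = \<phi> x \<oplus>\<^bsub>F\<^esub> \<phi> y \<and> \<phi> (x * y) = \<phi> x \<otimes>\<^bsub>F\<^esub> \<phi> y"
    by (simp_all add: car zero one add mult)
  ultimately show ?thesis by (intro exI[of _ F] exI[of _ \<phi>] conjI)
qed

text \<open>One ideal serves all of X: if it avoids the product of the non-zero elements of X, it
  avoids every factor.\<close>

theorem exists_reduction:
  fixes X :: "'a::field_char_0 set"
  assumes "finite X"
  shows "\<exists>R F \<phi>. reduction X R F \<phi>"
proof -
  obtain R where R: "X \<subseteq> R" "subring_of R" "subring_of.separated R"
    using finite_subset_separated[OF assms] by blast
  interpret subring_of R by (rule R(2))
  define b where "b = \<Prod>(X - {0})"
  have prod_mem: "\<Prod>A \<in> R" if "A \<subseteq> X" for A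
    using that R(1) by (induction A rule: infinite_finite_induct) auto
  then have "b \<in> R" unfolding b_def by auto
  moreover have "b \<noteq> 0" using assms by (simp add: b_def)
  ultimately obtain I where I: "finite_residue_field I" "b \<notin> I"
    using R(3) by (auto simp: separated_def)
  obtain F :: "nat ring" and \<phi> where h: "field F" "finite (carrier F)"
     "\<phi> ` R \<subseteq> carrier F" "\<phi> 0 = \<zero>\<^bsub>F\<^esub>" "\<phi> 1 = \<one>\<^bsub>F\<^esub>"
     "\<forall>x\<in>R. \<forall>y\<in>R. \<phi> (x + y) = \<phi> x \<oplus>\<^bsub>F\<^esub> \<phi> y \<and> \<phi> (x * y) = \<phi> x \<otimes>\<^bsub>F\<^esub> \<phi> y"
     "\<forall>x\<in>R. \<phi> x = \<zero>\<^bsub>F\<^esub> \<longrightarrow> x \<in> I"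
    using residue_class_map[OF I(1)] by blast
  have "x \<notin> I" if "x \<in> X" "x \<noteq> 0" for x
  proof
    assume "x \<in> I"
    have "b = x * \<Prod>(X - {0} - {x})" unfolding b_def using that assms by (subst prod.remove[of _ x]) auto
    moreover have "\<Prod>(X - {0} - {x}) \<in> R"
      by (intro prod_mem) auto
    ultimately have "b \<in> I" using ideal_ofD(5)[of I _ x] I \<open>x \<in> I\<close> by (simp add: finite_residue_field_def)
    then show False using I by simp
  qed
  then have "reduction X R F \<phi>" unfolding reduction_def using h R by blast
  then show ?thesis by blast
qed

subsection \<open>Rank over a field\<close>

context field
begin

text \<open>Associativity of row times matrix times column. The index sets are arbitrary because
  they will be sets of columns and inner index sets of factorizations as well as
  \<open>{..<n}\<close>.\<close>

lemma finsum_matrix_assoc: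
  assumes "finite K" "finite L"
    and "\<And>l. l \<in> L \<Longrightarrow> a l \<in> carrier R" "\<And>k. k \<in> K \<Longrightarrow> c k \<in> carrier R"
    and "\<And>l k. l \<in> L \<Longrightarrow> k \<in> K \<Longrightarrow> b l k \<in> carrier R"
  shows "(\<Oplus>k\<in>K. (\<Oplus>l\<in>L. a l \<otimes> b l k) \<otimes> c k) = (\<Oplus>l\<in>L. a l \<otimes> (\<Oplus>k\<in>K. b l k \<otimes> c k))"
  using assms(2,3,5)
proof (induction L)
  case empty
  have "(\<Oplus>k\<in>K. \<zero> \<otimes> c k) = (\<Oplus>k\<in>K. \<zero>)" using assms(4) by (intro finsum_cong') auto
  then show ?case by (simp add: finsum_zero)
next
  case (insert x L)
  have b: "(\<Oplus>l\<in>L. a l \<otimes> b l k) \<in> carrier R" if "k \<in> K" for k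
    using insert.prems that by (intro finsum_closed) auto
  have "(\<Oplus>k\<in>K. (\<Oplus>l\<in>insert x L. a l \<otimes> b l k) \<otimes> c k) =
      (\<Oplus>k\<in>K. a x \<otimes> (b x k \<otimes> c k) \<oplus> (\<Oplus>l\<in>L. a l \<otimes> b l k) \<otimes> c k)"
  proof (rule finsum_cong')
    fix k assume k: "k \<in> K"
    have "(\<Oplus>l\<in>insert x L. a l \<otimes> b l k) = a x \<otimes> b x k \<oplus> (\<Oplus>l\<in>L. a l \<otimes> b l k)"
      using insert k by (intro finsum_insert) auto
    then show "(\<Oplus>l\<in>insert x L. a l \<otimes> b l k) \<otimes> c k =
        a x \<otimes> (b x k \<otimes> c k) \<oplus> (\<Oplus>l\<in>L. a l \<otimes> b l k) \<otimes> c k"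
      using insert.prems k b[OF k] assms(4) by (simp add: l_distr m_assoc)
  qed (use insert.prems b assms(4) in auto)
  also have "\<dots> = (\<Oplus>k\<in>K. a x \<otimes> (b x k \<otimes> c k)) \<oplus> (\<Oplus>k\<in>K. (\<Oplus>l\<in>L. a l \<otimes> b l k) \<otimes> c k)"
    using insert.prems b assms(4) by (intro finsum_addf) auto
  also have "(\<Oplus>k\<in>K. a x \<otimes> (b x k \<otimes> c k)) = a x \<otimes> (\<Oplus>k\<in>K. b x k \<otimes> c k)"
    using insert.prems assms(1,4) by (intro finsum_rdistr[symmetric]) auto
  also have "(\<Oplus>k\<in>K. (\<Oplus>l\<in>L. a l \<otimes> b l k) \<otimes> c k) = (\<Oplus>l\<in>L. a l \<otimes> (\<Oplus>k\<in>K. b l k \<otimes> c k))"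
    using insert by auto
  also have "a x \<otimes> (\<Oplus>k\<in>K. b x k \<otimes> c k) \<oplus> \<dots> = (\<Oplus>l\<in>insert x L. a l \<otimes> (\<Oplus>k\<in>K. b l k \<otimes> c k))"
    using insert assms(4) by (intro finsum_insert[symmetric]) (auto intro!: finsum_closed)
  finally show ?case .
qed

text \<open>Gaussian elimination, by induction on the equations: either the equation m is trivial,
  or it is used to eliminate one unknown i and the shorter system still has more unknowns than
  equations.\<close>

lemma underdetermined_system:
  assumes "finite L" "finite S" "card L < card S"
    and "\<And>l j. l \<in> L \<Longrightarrow> j \<in> S \<Longrightarrow> Q l j \<in> carrier R"
  shows "\<exists>c. (\<forall>j\<in>S. c j \<in> carrier R) \<and> (\<exists>j\<in>S. c j \<noteq> \<zero>) \<and>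
    (\<forall>l\<in>L. (\<Oplus>j\<in>S. c j \<otimes> Q l j) = \<zero>)"
  using assms
proof (induction L arbitrary: S Q)
  case empty
  then have "S \<noteq> {}" by auto
  then show ?case by (intro exI[of _ "\<lambda>_. \<one>"]) auto
next
  case (insert m L)
  have Qc: "Q l j \<in> carrier R" if "l \<in> insert m L" "j \<in> S" for l j using insert.prems that by blast
  show ?case
  proof (cases "\<forall>j\<in>S. Q m j = \<zero>")
    case True
    have "card L < card S" using insert by simp
    then obtain c where c: "\<forall>j\<in>S. c j \<in> carrier R" "\<exists>j\<in>S. c j \<noteq> \<zero>"
      "\<forall>l\<in>L. (\<Oplus>j\<in>S. c j \<otimes> Q l j) = \<zero>"
      using insert.IH[of S Q] insert.prems by blast
    have "(\<Oplus>j\<in>S. c j \<otimes> Q m j) = \<zero>"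
      using True c by (intro add.finprod_one_eqI) auto
    then show ?thesis using c by (intro exI[of _ c]) auto
  next
    case False
    then obtain i where i: "i \<in> S" "Q m i \<noteq> \<zero>" by blast
    define S' where "S' = S - {i}"
    define p where "p = inv (Q m i)"
    have p: "p \<in> carrier R" "p \<otimes> Q m i = \<one>" "Q m i \<otimes> p = \<one>"
      using i Qc[of m i] field_Units by (auto simp: p_def)
    \<comment> \<open>The multiplier for which adding k l times the equation m to the equation l
      clears the unknown i.\<close>
    define k where "k l = \<ominus> (Q l i \<otimes> p)" for l
    have kc: "k l \<in> carrier R" if "l \<in> insert m L" for l using Qc[OF that i(1)] p by (simp add: k_def)
    have S': "finite S'" "card L < card S'" "S = insert i S'" "i \<notin> S'"
      using insert i by (auto simp: S'_def)
    obtain c where c: "\<forall>j\<in>S'. c j \<in> carrier R" "\<exists>j\<in>S'. c j \<noteq> \<zero>"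
      "\<forall>l\<in>L. (\<Oplus>j\<in>S'. c j \<otimes> (Q l j \<oplus> k l \<otimes> Q m j)) = \<zero>"
      using insert.IH[of S' "\<lambda>l j. Q l j \<oplus> k l \<otimes> Q m j"] S' Qc kc by auto
    define s where "s = (\<Oplus>j\<in>S'. c j \<otimes> Q m j)"
    have s: "s \<in> carrier R" unfolding s_def using c Qc S' by (intro finsum_closed) auto
    \<comment> \<open>Back substitution: the value at i is the one that solves the equation m, given
      the other unknowns.\<close>
    define c' where "c' = c(i := \<ominus> p \<otimes> s)"
    have sums: "(\<Oplus>j\<in>S. c' j \<otimes> Q l j) = k l \<otimes> s \<oplus> (\<Oplus>j\<in>S'. c j \<otimes> Q l j)" if l: "l \<in> insert m L" for l
    proof -
      have "(\<Oplus>j\<in>S. c' j \<otimes> Q l j) = c' i \<otimes> Q l i \<oplus> (\<Oplus>j\<in>S'. c' j \<otimes> Q l j)"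
        unfolding S'(3) using S' c p s Qc l by (intro finsum_insert) (auto simp: c'_def)
      also have "(\<Oplus>j\<in>S'. c' j \<otimes> Q l j) = (\<Oplus>j\<in>S'. c j \<otimes> Q l j)"
        using S' c Qc l by (intro finsum_cong') (auto simp: c'_def)
      also have "c' i \<otimes> Q l i = k l \<otimes> s"
        using p s Qc[OF l i(1)] by (simp add: c'_def k_def l_minus r_minus m_ac)
      finally show ?thesis .
    qed
    have "(\<Oplus>j\<in>S. c' j \<otimes> Q l j) = \<zero>" if l: "l \<in> insert m L" for l
    proof (cases "l = m")
      case True
      then have "k l = \<ominus> \<one>" using p by (simp add: k_def)
      then show ?thesis using sums[OF l] s True by (simp add: s_def[symmetric] l_minus l_neg)
    next
      case False
      then have "l \<in> L" using l by simp
      have "(\<Oplus>j\<in>S'. c j \<otimes> (Q l j \<oplus> k l \<otimes> Q m j)) = (\<Oplus>j\<in>S'. k l \<otimes> (c j \<otimes> Q m j) \<oplus> c j \<otimes> Q l j)"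
        using c Qc kc l S' by (intro finsum_cong') (auto simp: r_distr m_ac a_comm)
      also have "\<dots> = (\<Oplus>j\<in>S'. k l \<otimes> (c j \<otimes> Q m j)) \<oplus> (\<Oplus>j\<in>S'. c j \<otimes> Q l j)"
        using c Qc kc l S' by (intro finsum_addf) auto
      also have "(\<Oplus>j\<in>S'. k l \<otimes> (c j \<otimes> Q m j)) = k l \<otimes> s"
        unfolding s_def using c Qc kc l S' by (intro finsum_rdistr[symmetric]) auto
      finally show ?thesis using sums[OF l] c(3) \<open>l \<in> L\<close> by simp
    qed
    moreover have "\<forall>j\<in>S. c' j \<in> carrier R" "\<exists>j\<in>S. c' j \<noteq> \<zero>"
      using c p s S' by (auto simp: c'_def)
    ultimately show ?thesis by blast
  qed
qed

text \<open>The empty set of columns is independent, so the \<open>Max\<close> in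
  \<open>mat_rank\<close> ranges over a non-empty finite set and is attained.\<close>

lemma mat_rank_set:
  "finite {card S | S. S \<subseteq> {..<n} \<and> lin_indep_cols R n A S}"
  "\<exists>S. S \<subseteq> {..<n} \<and> lin_indep_cols R n A S \<and> card S = mat_rank R n A"
proof -
  have "{card S | S. S \<subseteq> {..<n} \<and> lin_indep_cols R n A S} = card ` {S. S \<subseteq> {..<n} \<and> lin_indep_cols R n A S}"
    by auto
  then show fin: "finite {card S | S. S \<subseteq> {..<n} \<and> lin_indep_cols R n A S}"
    by simp
  have "lin_indep_cols R n A {}" by (simp add: lin_indep_cols_def)
  then have "{card S | S. S \<subseteq> {..<n} \<and> lin_indep_cols R n A S} \<noteq> {}" by blast
  from Max_in[OF fin this]
  show "\<exists>S. S \<subseteq> {..<n} \<and> lin_indep_cols R n A S \<and> card S = mat_rank R n A"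
    unfolding mat_rank_def by auto
qed

lemma card_le_mat_rank: "S \<subseteq> {..<n} \<Longrightarrow> lin_indep_cols R n A S \<Longrightarrow> card S \<le> mat_rank R n A"
  unfolding mat_rank_def by (rule Max_ge[OF mat_rank_set(1)]) blast

text \<open>A = P Q with inner index set L. The rank is the least size of such an L, by the two
  lemmas \<open>mat_rank_le_factor\<close> and \<open>mat_rank_factorization\<close>; all properties
  of the rank metric are derived from this description instead of from a theory of
  dimension.\<close>

definition factorization :: "nat \<Rightarrow> (nat \<Rightarrow> nat \<Rightarrow> 'a) \<Rightarrow> 'l set \<Rightarrow> (nat \<Rightarrow> 'l \<Rightarrow> 'a) \<Rightarrow> ('l \<Rightarrow> nat \<Rightarrow> 'a) \<Rightarrow> bool" where
  "factorization n A L P Q \<longleftrightarrow> finite L \<and>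
    (\<forall>i<n. \<forall>l\<in>L. P i l \<in> carrier R) \<and> (\<forall>l\<in>L. \<forall>j<n. Q l j \<in> carrier R) \<and>
    (\<forall>i<n. \<forall>j<n. A i j = (\<Oplus>l\<in>L. P i l \<otimes> Q l j))"

lemma factorizationD:
  assumes "factorization n A L P Q"
  shows "finite L" "i < n \<Longrightarrow> l \<in> L \<Longrightarrow> P i l \<in> carrier R" "l \<in> L \<Longrightarrow> j < n \<Longrightarrow> Q l j \<in> carrier R"
    "i < n \<Longrightarrow> j < n \<Longrightarrow> A i j = (\<Oplus>l\<in>L. P i l \<otimes> Q l j)"
  using assms by (auto simp: factorization_def)

text \<open>Given more than \<open>card L\<close> independent columns, the system Q c = 0 restricted
  to them has a non-trivial solution, which A = P Q then annihilates as well. L may have any type,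
  so that two factorizations can be joined over a sum type.\<close>

lemma mat_rank_le_factor:
  assumes L: "finite L" and P: "\<And>i l. i < n \<Longrightarrow> l \<in> L \<Longrightarrow> P i l \<in> carrier R"
    and Q: "\<And>l j. l \<in> L \<Longrightarrow> j < n \<Longrightarrow> Q l j \<in> carrier R"
    and A: "\<And>i j. i < n \<Longrightarrow> j < n \<Longrightarrow> A i j = (\<Oplus>l\<in>L. P i l \<otimes> Q l j)"
  shows "mat_rank R n A \<le> card L"
proof (rule ccontr)
  assume "\<not> ?thesis"
  moreover obtain S where S: "S \<subseteq> {..<n}" "lin_indep_cols R n A S" "card S = mat_rank R n A"
    using mat_rank_set(2) by blast
  ultimately have "card L < card S" by simp
  moreover have fS: "finite S" using S finite_subset by blast
  ultimately obtain c where c: "\<forall>j\<in>S. c j \<in> carrier R" "\<exists>j\<in>S. c j \<noteq> \<zero>"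
    "\<forall>l\<in>L. (\<Oplus>j\<in>S. c j \<otimes> Q l j) = \<zero>"
    using underdetermined_system[OF L, of S Q] Q S(1) by blast
  have "(\<Oplus>j\<in>S. c j \<otimes> A i j) = \<zero>" if i: "i < n" for i
  proof -
    have "(\<Oplus>j\<in>S. c j \<otimes> A i j) = (\<Oplus>j\<in>S. (\<Oplus>l\<in>L. P i l \<otimes> Q l j) \<otimes> c j)"
      using c S P Q i by (intro finsum_cong') (auto simp: A m_comm subset_eq intro!: finsum_closed)
    also have "\<dots> = (\<Oplus>l\<in>L. P i l \<otimes> (\<Oplus>j\<in>S. Q l j \<otimes> c j))"
      using c S P Q i L fS by (intro finsum_matrix_assoc) auto
    also have "\<dots> = \<zero>"
    proof (intro add.finprod_one_eqI)
      fix l assume l: "l \<in> L"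
      have "(\<Oplus>j\<in>S. Q l j \<otimes> c j) = (\<Oplus>j\<in>S. c j \<otimes> Q l j)"
        using c S Q l by (intro finsum_cong') (auto simp: m_comm subset_eq)
      then show "P i l \<otimes> (\<Oplus>j\<in>S. Q l j \<otimes> c j) = \<zero>" using c l P i by simp
    qed
    finally show ?thesis .
  qed
  then show False using S(2) c unfolding lin_indep_cols_def by blast
qed

text \<open>Take for P the columns of A in an independent set S of maximal size; Q holds the
  coordinates of all columns with respect to them.\<close>

lemma mat_rank_factorization:
  assumes A: "\<And>i j. i < n \<Longrightarrow> j < n \<Longrightarrow> A i j \<in> carrier R"
  shows "\<exists>(L :: nat set) P Q. card L = mat_rank R n A \<and> factorization n A L P Q"
proof -
  obtain S where S: "S \<subseteq> {..<n}" "lin_indep_cols R n A S" "card S = mat_rank R n A"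
    using mat_rank_set(2) by blast
  have fS: "finite S" using S finite_subset by blast
  have "\<exists>q. (\<forall>l\<in>S. q l \<in> carrier R) \<and> (\<forall>i<n. A i j = (\<Oplus>l\<in>S. A i l \<otimes> q l))" if j: "j < n" for j
  proof (cases "j \<in> S")
    case True
    have "A i j = (\<Oplus>l\<in>S. A i l \<otimes> (if j = l then \<one> else \<zero>))" if i: "i < n" for i
    proof -
      have "(\<Oplus>l\<in>S. A i l \<otimes> (if j = l then \<one> else \<zero>)) = (\<Oplus>l\<in>S. if j = l then A i l else \<zero>)"
        using A i S by (intro finsum_cong') (auto simp: subset_eq)
      also have "\<dots> = A i j" using True fS A i S by (intro finsum_singleton) auto
      finally show ?thesis by simp
    qed
    then show ?thesis by (intro exI[of _ "\<lambda>l. if j = l then \<one> else \<zero>"]) auto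
  next
    case False
    \<comment> \<open>Maximality of S gives a relation involving the column j. Its coefficient at j
      is non-zero, since S is independent, so the relation can be solved for that column.\<close>
    have "\<not> lin_indep_cols R n A (insert j S)"
    proof
      assume "lin_indep_cols R n A (insert j S)"
      then have "card (insert j S) \<le> mat_rank R n A" using S j by (intro card_le_mat_rank) auto
      then show False using False fS S by simp
    qed
    then obtain c where c: "\<forall>k\<in>insert j S. c k \<in> carrier R" "\<exists>k\<in>insert j S. c k \<noteq> \<zero>"
      "\<forall>i<n. (\<Oplus>k\<in>insert j S. c k \<otimes> A i k) = \<zero>"
      unfolding lin_indep_cols_def by blast
    have eq: "c j \<otimes> A i j \<oplus> (\<Oplus>k\<in>S. c k \<otimes> A i k) = \<zero>" if i: "i < n" for i
    proof -
      have "(\<Oplus>k\<in>insert j S. c k \<otimes> A i k) = c j \<otimes> A i j \<oplus> (\<Oplus>k\<in>S. c k \<otimes> A i k)"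
        using c A i j S fS False by (intro finsum_insert) auto
      then show ?thesis using c i by simp
    qed
    have cj: "c j \<in> carrier R" "c j \<noteq> \<zero>"
    proof -
      show "c j \<noteq> \<zero>"
      proof
        assume 0: "c j = \<zero>"
        have "(\<Oplus>k\<in>S. c k \<otimes> A i k) = \<zero>" if i: "i < n" for i
        proof -
          have "(\<Oplus>k\<in>S. c k \<otimes> A i k) \<in> carrier R" using c A i S by (intro finsum_closed) auto
          then show ?thesis using eq[OF i] 0 A[OF i j] by simp
        qed
        then have "\<forall>k\<in>S. c k = \<zero>" using S(2) c unfolding lin_indep_cols_def by blast
        then show False using c 0 by auto
      qed
    qed (use c in simp)
    define p where "p = inv (c j)"
    have p: "p \<in> carrier R" "p \<otimes> c j = \<one>" using cj field_Units by (auto simp: p_def)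
    have "A i j = (\<Oplus>l\<in>S. A i l \<otimes> (\<ominus> p \<otimes> c l))" if i: "i < n" for i
    proof -
      define t where "t = (\<Oplus>k\<in>S. c k \<otimes> A i k)"
      have t: "t \<in> carrier R" unfolding t_def using c A i S by (intro finsum_closed) auto
      have "(\<Oplus>l\<in>S. A i l \<otimes> (\<ominus> p \<otimes> c l)) = (\<Oplus>l\<in>S. \<ominus> p \<otimes> (c l \<otimes> A i l))"
        using A i c S p by (intro finsum_cong') (auto simp: m_ac subset_eq)
      also have "\<dots> = \<ominus> p \<otimes> t"
        unfolding t_def using A i c S p fS by (intro finsum_rdistr[symmetric]) auto
      also have "t = \<ominus> (c j \<otimes> A i j)"
        using eq[OF i] t A[OF i j] cj minus_equality[of t "c j \<otimes> A i j"]
        by (simp add: t_def[symmetric] a_comm)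
      also have "\<ominus> p \<otimes> \<ominus> (c j \<otimes> A i j) = p \<otimes> c j \<otimes> A i j"
        using p cj A[OF i j] by (simp add: l_minus r_minus m_assoc[symmetric])
      finally show ?thesis using p A[OF i j] by simp
    qed
    then show ?thesis using p c by (intro exI[of _ "\<lambda>l. \<ominus> p \<otimes> c l"]) auto
  qed
  then obtain q where q: "\<And>j. j < n \<Longrightarrow> (\<forall>l\<in>S. q j l \<in> carrier R) \<and> (\<forall>i<n. A i j = (\<Oplus>l\<in>S. A i l \<otimes> q j l))"
    by metis
  have "factorization n A S A (\<lambda>l j. q j l)"
    unfolding factorization_def using fS S q A by auto
  then show ?thesis using S(3) by blast
qed

end

section \<open>Matrix algebra, general linear groups and the rank metric\<close>

context field
begin

lemma matsD: "A \<in> mats R n \<Longrightarrow> i < n \<Longrightarrow> j < n \<Longrightarrow> A i j \<in> carrier R"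
  by (simp add: mats_def)

lemma mats_eqI:
  assumes "A \<in> mats R n" "B \<in> mats R n" and eq: "\<And>i j. i < n \<Longrightarrow> j < n \<Longrightarrow> A i j = B i j"
  shows "A = B"
proof (intro ext)
  fix i j
  show "A i j = B i j"
  proof (cases "i < n \<and> j < n")
    case True
    then show ?thesis by (simp add: eq)
  next
    case False
    then have "n \<le> i \<or> n \<le> j" by auto
    then show ?thesis using assms(1,2) unfolding mats_def by auto
  qed
qed

lemma mat_mult_mats: "A \<in> mats R n \<Longrightarrow> B \<in> mats R n \<Longrightarrow> mat_mult R n A B \<in> mats R n"
  by (auto simp: mats_def mat_mult_def intro!: finsum_closed)

lemma mat_one_mats: "mat_one R n \<in> mats R n"
  by (auto simp: mats_def mat_one_def)

lemma mat_minus_mats: "A \<in> mats R n \<Longrightarrow> B \<in> mats R n \<Longrightarrow> mat_minus R n A B \<in> mats R n"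
  by (auto simp: mats_def mat_minus_def)

lemma mat_mult_assoc:
  assumes "A \<in> mats R n" "B \<in> mats R n" "C \<in> mats R n"
  shows "mat_mult R n (mat_mult R n A B) C = mat_mult R n A (mat_mult R n B C)"
proof (rule mats_eqI[of _ n])
  fix i j assume ij: "i < n" "j < n"
  have "mat_mult R n (mat_mult R n A B) C i j = (\<Oplus>k\<in>{..<n}. (\<Oplus>l\<in>{..<n}. A i l \<otimes> B l k) \<otimes> C k j)"
    using ij assms by (auto simp: mat_mult_def matsD intro!: finsum_cong' finsum_closed)
  also have "\<dots> = (\<Oplus>l\<in>{..<n}. A i l \<otimes> (\<Oplus>k\<in>{..<n}. B l k \<otimes> C k j))"
    using ij assms by (intro finsum_matrix_assoc) (auto simp: matsD)
  also have "\<dots> = mat_mult R n A (mat_mult R n B C) i j"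
    using ij assms by (auto simp: mat_mult_def matsD intro!: finsum_cong' finsum_closed)
  finally show "mat_mult R n (mat_mult R n A B) C i j = mat_mult R n A (mat_mult R n B C) i j" .
qed (auto intro!: mat_mult_mats assms)

lemma mat_mult_one:
  assumes "A \<in> mats R n"
  shows "mat_mult R n (mat_one R n) A = A" "mat_mult R n A (mat_one R n) = A"
proof -
  have "(\<Oplus>l\<in>{..<n}. mat_one R n i l \<otimes> A l j) = A i j" if "i < n" "j < n" for i j
  proof -
    have "(\<Oplus>l\<in>{..<n}. mat_one R n i l \<otimes> A l j) = (\<Oplus>l\<in>{..<n}. if i = l then A l j else \<zero>)"
      using assms that by (intro finsum_cong') (auto simp: mat_one_def matsD)
    also have "\<dots> = A i j" using that assms by (intro finsum_singleton) (auto simp: matsD)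
    finally show ?thesis .
  qed
  then show "mat_mult R n (mat_one R n) A = A"
    using assms by (intro mats_eqI[of _ n] mat_mult_mats mat_one_mats) (auto simp: mat_mult_def)
  have "(\<Oplus>l\<in>{..<n}. A i l \<otimes> mat_one R n l j) = A i j" if "i < n" "j < n" for i j
  proof -
    have "(\<Oplus>l\<in>{..<n}. A i l \<otimes> mat_one R n l j) = (\<Oplus>l\<in>{..<n}. if j = l then A i l else \<zero>)"
      using assms that by (intro finsum_cong') (auto simp: mat_one_def matsD)
    also have "\<dots> = A i j" using that assms by (intro finsum_singleton) (auto simp: matsD)
    finally show ?thesis .
  qed
  then show "mat_mult R n A (mat_one R n) = A"
    using assms by (intro mats_eqI[of _ n] mat_mult_mats mat_one_mats) (auto simp: mat_mult_def)
qed

lemma GL_mats: "A \<in> GL R n \<Longrightarrow> A \<in> mats R n"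
  by (simp add: GL_def)

lemma mat_mult_GL:
  assumes "A \<in> GL R n" "B \<in> GL R n"
  shows "mat_mult R n A B \<in> GL R n"
proof -
  obtain A' B' where h: "A' \<in> mats R n" "mat_mult R n A A' = mat_one R n" "mat_mult R n A' A = mat_one R n"
    "B' \<in> mats R n" "mat_mult R n B B' = mat_one R n" "mat_mult R n B' B = mat_one R n"
    using assms by (auto simp: GL_def)
  note m = assms[THEN GL_mats] h(1,4)
  have "mat_mult R n (mat_mult R n A B) (mat_mult R n B' A') = mat_one R n"
    using m h by (simp add: mat_mult_assoc mat_mult_mats)
      (simp add: mat_mult_assoc[symmetric] mat_mult_mats mat_mult_one)
  moreover have "mat_mult R n (mat_mult R n B' A') (mat_mult R n A B) = mat_one R n"
    using m h by (simp add: mat_mult_assoc mat_mult_mats)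
      (simp add: mat_mult_assoc[symmetric] mat_mult_mats mat_mult_one)
  ultimately show ?thesis unfolding GL_def using m by (blast intro: mat_mult_mats)
qed

lemma group_GL_grp: "group (GL_grp R n)"
proof (rule groupI)
  show "\<one>\<^bsub>GL_grp R n\<^esub> \<in> carrier (GL_grp R n)"
    using mat_mult_one[OF mat_one_mats] mat_one_mats by (auto simp: GL_grp_def GL_def)
next
  fix A assume "A \<in> carrier (GL_grp R n)"
  then obtain B where "A \<in> mats R n" "B \<in> mats R n" "mat_mult R n A B = mat_one R n" "mat_mult R n B A = mat_one R n"
    by (auto simp: GL_grp_def GL_def)
  then show "\<exists>B\<in>carrier (GL_grp R n). B \<otimes>\<^bsub>GL_grp R n\<^esub> A = \<one>\<^bsub>GL_grp R n\<^esub>"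
    by (intro bexI[of _ B]) (auto simp: GL_grp_def GL_def)
qed (auto simp: GL_grp_def mat_mult_GL mat_mult_assoc mat_mult_one GL_mats)

text \<open>M (P Q) = (M P) Q and (P Q) M = P (Q M) have the same inner index set as P Q.\<close>

lemma mat_rank_mult_le:
  assumes A: "A \<in> mats R n" and M: "M \<in> mats R n"
  shows "mat_rank R n (mat_mult R n M A) \<le> mat_rank R n A"
    "mat_rank R n (mat_mult R n A M) \<le> mat_rank R n A"
proof -
  obtain L :: "nat set" and P Q where h0: "card L = mat_rank R n A" "factorization n A L P Q"
    using mat_rank_factorization[of n A, OF matsD[OF A]] by blast
  note h = factorizationD(1)[OF h0(2)] h0(1) factorizationD(2,3,4)[OF h0(2)]
  note M' = matsD[OF M]
  show "mat_rank R n (mat_mult R n M A) \<le> mat_rank R n A"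
    unfolding h(2)[symmetric]
  proof (rule mat_rank_le_factor[OF h(1)])
    fix i j assume ij: "i < n" "j < n"
    have "mat_mult R n M A i j = (\<Oplus>k\<in>{..<n}. M i k \<otimes> (\<Oplus>l\<in>L. P k l \<otimes> Q l j))"
      using ij h M' by (auto simp: mat_mult_def intro!: finsum_cong' finsum_closed)
    also have "\<dots> = (\<Oplus>l\<in>L. (\<Oplus>k\<in>{..<n}. M i k \<otimes> P k l) \<otimes> Q l j)"
      using ij h M' by (intro finsum_matrix_assoc[symmetric]) auto
    finally show "mat_mult R n M A i j = (\<Oplus>l\<in>L. (\<Oplus>k\<in>{..<n}. M i k \<otimes> P k l) \<otimes> Q l j)" .
  qed (use h M' in \<open>auto intro!: finsum_closed\<close>)
  show "mat_rank R n (mat_mult R n A M) \<le> mat_rank R n A"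
    unfolding h(2)[symmetric]
  proof (rule mat_rank_le_factor[OF h(1)])
    fix i j assume ij: "i < n" "j < n"
    have "mat_mult R n A M i j = (\<Oplus>k\<in>{..<n}. (\<Oplus>l\<in>L. P i l \<otimes> Q l k) \<otimes> M k j)"
      using ij h M' by (auto simp: mat_mult_def intro!: finsum_cong' finsum_closed)
    also have "\<dots> = (\<Oplus>l\<in>L. P i l \<otimes> (\<Oplus>k\<in>{..<n}. Q l k \<otimes> M k j))"
      using ij h M' by (intro finsum_matrix_assoc) auto
    finally show "mat_mult R n A M i j = (\<Oplus>l\<in>L. P i l \<otimes> (\<Oplus>k\<in>{..<n}. Q l k \<otimes> M k j))" .
  qed (use h M' in \<open>auto intro!: finsum_closed\<close>)
qed

text \<open>Multiplication by M and then by its inverse gives A back, so neither step can lower the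
  rank.\<close>

lemma mat_rank_mult_GL:
  assumes A: "A \<in> mats R n" and M: "M \<in> GL R n"
  shows "mat_rank R n (mat_mult R n M A) = mat_rank R n A"
    "mat_rank R n (mat_mult R n A M) = mat_rank R n A"
proof -
  obtain N where N: "M \<in> mats R n" "N \<in> mats R n" "mat_mult R n M N = mat_one R n" "mat_mult R n N M = mat_one R n"
    using M by (auto simp: GL_def)
  have "mat_mult R n N (mat_mult R n M A) = A" "mat_mult R n (mat_mult R n A M) N = A"
    using A N by (simp_all add: mat_mult_one mat_mult_assoc[symmetric])
      (simp add: mat_mult_assoc mat_mult_one)
  then show "mat_rank R n (mat_mult R n M A) = mat_rank R n A"
    "mat_rank R n (mat_mult R n A M) = mat_rank R n A"
    using mat_rank_mult_le(1)[OF mat_mult_mats[OF N(1) A] N(2)] mat_rank_mult_le(1)[OF A N(1)]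
      mat_rank_mult_le(2)[OF mat_mult_mats[OF A N(1)] N(2)] mat_rank_mult_le(2)[OF A N(1)]
    by simp_all
qed

lemma mat_rank_minus_commute_le:
  assumes A: "A \<in> mats R n" and B: "B \<in> mats R n"
  shows "mat_rank R n (mat_minus R n A B) \<le> mat_rank R n (mat_minus R n B A)"
proof -
  obtain L :: "nat set" and P Q where h0: "card L = mat_rank R n (mat_minus R n B A)" "factorization n (mat_minus R n B A) L P Q"
    using mat_rank_factorization[of n "mat_minus R n B A", OF matsD[OF mat_minus_mats[OF B A]]] by blast
  note h = factorizationD(1)[OF h0(2)] h0(1) factorizationD(2,3,4)[OF h0(2)]
  show ?thesis
    unfolding h(2)[symmetric]
  proof (rule mat_rank_le_factor[OF h(1)])
    fix i j assume ij: "i < n" "j < n"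
    have "mat_minus R n A B i j = \<ominus> \<one> \<otimes> mat_minus R n B A i j"
      using ij matsD[OF A ij] matsD[OF B ij] by (simp add: mat_minus_def minus_eq l_minus minus_add a_comm)
    also have "\<dots> = (\<Oplus>l\<in>L. \<ominus> \<one> \<otimes> (P i l \<otimes> Q l j))"
      unfolding h(5)[OF ij] using h ij by (intro finsum_rdistr) auto
    also have "\<dots> = (\<Oplus>l\<in>L. (\<ominus> \<one> \<otimes> P i l) \<otimes> Q l j)"
      using h ij by (intro finsum_cong') (auto simp: m_assoc)
    finally show "mat_minus R n A B i j = (\<Oplus>l\<in>L. (\<ominus> \<one> \<otimes> P i l) \<otimes> Q l j)" .
  qed (use h in auto)
qed

text \<open>A - C is the sum of A - B and B - C. Placing the left factors side by side and the right
  factors on top of each other factors this sum over the disjoint union of the two inner index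
  sets.\<close>

lemma mat_rank_triangle:
  assumes A: "A \<in> mats R n" and B: "B \<in> mats R n" and C: "C \<in> mats R n"
  shows "mat_rank R n (mat_minus R n A C) \<le> mat_rank R n (mat_minus R n A B) + mat_rank R n (mat_minus R n B C)"
proof -
  obtain L :: "nat set" and P Q where h0: "card L = mat_rank R n (mat_minus R n A B)" "factorization n (mat_minus R n A B) L P Q"
    using mat_rank_factorization[of n "mat_minus R n A B", OF matsD[OF mat_minus_mats[OF A B]]] by blast
  note h = factorizationD(1)[OF h0(2)] h0(1) factorizationD(2,3,4)[OF h0(2)]
  obtain L' :: "nat set" and P' Q' where h0': "card L' = mat_rank R n (mat_minus R n B C)" "factorization n (mat_minus R n B C) L' P' Q'"
    using mat_rank_factorization[of n "mat_minus R n B C", OF matsD[OF mat_minus_mats[OF B C]]] by blast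
  note h' = factorizationD(1)[OF h0'(2)] h0'(1) factorizationD(2,3,4)[OF h0'(2)]
  define p where "p i = case_sum (P i) (P' i)" for i
  define q where "q = case_sum Q Q'"
  have "mat_rank R n (mat_minus R n A C) \<le> card (Inl ` L \<union> Inr ` L')"
  proof (rule mat_rank_le_factor)
    show "finite (Inl ` L \<union> Inr ` L')" using h h' by simp
    show "p i l \<in> carrier R" if "i < n" "l \<in> Inl ` L \<union> Inr ` L'" for i l
      using that h h' by (auto simp: p_def)
    show "q l j \<in> carrier R" if "l \<in> Inl ` L \<union> Inr ` L'" "j < n" for j l
      using that h h' by (auto simp: q_def)
    fix i j assume ij: "i < n" "j < n"
    have "mat_minus R n A C i j = mat_minus R n A B i j \<oplus> mat_minus R n B C i j"
    proof -
      have a: "a \<ominus> c = (a \<ominus> b) \<oplus> (b \<ominus> c)" if "a \<in> carrier R" "b \<in> carrier R" "c \<in> carrier R" for a b c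
        using that by (simp add: minus_eq a_assoc r_neg1)
      show ?thesis using ij a[OF matsD[OF A ij] matsD[OF B ij] matsD[OF C ij]] by (simp add: mat_minus_def)
    qed
    also have "\<dots> = (\<Oplus>l\<in>L. p i (Inl l) \<otimes> q (Inl l) j) \<oplus> (\<Oplus>l\<in>L'. p i (Inr l) \<otimes> q (Inr l) j)"
      using h(5)[OF ij] h'(5)[OF ij] by (simp add: p_def q_def)
    also have "\<dots> = (\<Oplus>l\<in>Inl ` L. p i l \<otimes> q l j) \<oplus> (\<Oplus>l\<in>Inr ` L'. p i l \<otimes> q l j)"
      using ij h h' by (subst (1 2) finsum_reindex) (auto simp: p_def q_def)
    also have "\<dots> = (\<Oplus>l\<in>Inl ` L \<union> Inr ` L'. p i l \<otimes> q l j)"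
      using ij h h' by (intro finsum_Un_disjoint[symmetric]) (auto simp: p_def q_def)
    finally show "mat_minus R n A C i j = (\<Oplus>l\<in>Inl ` L \<union> Inr ` L'. p i l \<otimes> q l j)" .
  qed
  also have "\<dots> = card L + card L'"
    using h h' by (subst card_Un_disjoint) (auto simp: card_image)
  finally show ?thesis using h h' by simp
qed

text \<open>Rank 0 means a factorization over an empty inner index set, where every entry is an
  empty sum.\<close>

lemma mat_rank_minus_eq_0_iff:
  assumes A: "A \<in> mats R n" and B: "B \<in> mats R n"
  shows "mat_rank R n (mat_minus R n A B) = 0 \<longleftrightarrow> A = B"
proof
  assume 0: "mat_rank R n (mat_minus R n A B) = 0"
  have "mat_minus R n A B i j = \<zero>" if "i < n" "j < n" for i j
    using mat_rank_factorization[of n "mat_minus R n A B", OF matsD[OF mat_minus_mats[OF A B]]] that 0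
    by (auto simp: factorization_def)
  then have "A i j = B i j" if "i < n" "j < n" for i j
    using that matsD[OF A that] matsD[OF B that] minus_equality[of "A i j" "\<ominus> B i j"]
    by (auto simp: mat_minus_def minus_eq)
  then show "A = B" using A B mats_eqI by blast
next
  assume "A = B"
  then have "mat_minus R n A B i j = \<zero>" if "i < n" "j < n" for i j
    using matsD[OF A that] that by (simp add: mat_minus_def minus_eq r_neg)
  then have "mat_rank R n (mat_minus R n A B) \<le> card ({} :: nat set)"
    by (intro mat_rank_le_factor[where P = "\<lambda>_ _. \<zero>" and Q = "\<lambda>_ _. \<zero>"]) (simp_all add: finsum_empty)
  then show "mat_rank R n (mat_minus R n A B) = 0" by simp
qed

lemma mat_minus_mult:
  assumes "A \<in> mats R n" "B \<in> mats R n" "M \<in> mats R n"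
  shows "mat_minus R n (mat_mult R n M A) (mat_mult R n M B) = mat_mult R n M (mat_minus R n A B)"
    "mat_minus R n (mat_mult R n A M) (mat_mult R n B M) = mat_mult R n (mat_minus R n A B) M"
proof -
  note m = assms[THEN matsD]
  have neg: "\<ominus> x = \<ominus> \<one> \<otimes> x" if "x \<in> carrier R" for x using that by (simp add: l_minus)
  have sub: "(\<Oplus>l\<in>{..<n}. f l) \<ominus> (\<Oplus>l\<in>{..<n}. g l) = (\<Oplus>l\<in>{..<n}. f l \<ominus> g l)"
    if fg: "\<And>l. l < n \<Longrightarrow> f l \<in> carrier R" "\<And>l. l < n \<Longrightarrow> g l \<in> carrier R" for f g :: "nat \<Rightarrow> 'a"
  proof -
    have "(\<Oplus>l\<in>{..<n}. g l) \<in> carrier R" using fg by (intro finsum_closed) auto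
    then have "\<ominus> (\<Oplus>l\<in>{..<n}. g l) = \<ominus> \<one> \<otimes> (\<Oplus>l\<in>{..<n}. g l)" by (rule neg)
    also have "\<dots> = (\<Oplus>l\<in>{..<n}. \<ominus> \<one> \<otimes> g l)" using fg by (intro finsum_rdistr) auto
    also have "\<dots> = (\<Oplus>l\<in>{..<n}. \<ominus> g l)" using fg by (intro finsum_cong') (auto simp: neg[symmetric])
    finally show ?thesis using fg finsum_addf[of f "{..<n}" "\<lambda>l. \<ominus> g l"] by (simp add: minus_eq Pi_def)
  qed
  show "mat_minus R n (mat_mult R n M A) (mat_mult R n M B) = mat_mult R n M (mat_minus R n A B)"
  proof (rule mats_eqI[of _ n])
    fix i j assume ij: "i < n" "j < n"
    have "mat_minus R n (mat_mult R n M A) (mat_mult R n M B) i j = (\<Oplus>l\<in>{..<n}. M i l \<otimes> A l j \<ominus> M i l \<otimes> B l j)"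
      using ij m by (simp add: mat_minus_def mat_mult_def sub)
    also have "\<dots> = (\<Oplus>l\<in>{..<n}. M i l \<otimes> mat_minus R n A B l j)"
    proof (rule finsum_cong')
      fix l assume "l \<in> {..<n}"
      then have l: "l < n" by simp
      show "M i l \<otimes> A l j \<ominus> M i l \<otimes> B l j = M i l \<otimes> mat_minus R n A B l j"
        using ij l m(1,2)[of l j] m(3)[of i l]
        by (simp add: mat_minus_def minus_eq r_distr r_minus l_distr l_minus)
    qed (use ij m mat_minus_mats[OF assms(1,2), THEN matsD] in auto)
    also have "\<dots> = mat_mult R n M (mat_minus R n A B) i j"
      using ij by (simp add: mat_mult_def)
    finally show "mat_minus R n (mat_mult R n M A) (mat_mult R n M B) i j = mat_mult R n M (mat_minus R n A B) i j" .
  qed (intro mat_mult_mats mat_minus_mats assms)+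
  show "mat_minus R n (mat_mult R n A M) (mat_mult R n B M) = mat_mult R n (mat_minus R n A B) M"
  proof (rule mats_eqI[of _ n])
    fix i j assume ij: "i < n" "j < n"
    have "mat_minus R n (mat_mult R n A M) (mat_mult R n B M) i j = (\<Oplus>l\<in>{..<n}. A i l \<otimes> M l j \<ominus> B i l \<otimes> M l j)"
      using ij m by (simp add: mat_minus_def mat_mult_def sub)
    also have "\<dots> = (\<Oplus>l\<in>{..<n}. mat_minus R n A B i l \<otimes> M l j)"
    proof (rule finsum_cong')
      fix l assume "l \<in> {..<n}"
      then have l: "l < n" by simp
      show "A i l \<otimes> M l j \<ominus> B i l \<otimes> M l j = mat_minus R n A B i l \<otimes> M l j"
        using ij l m(1,2)[of i l] m(3)[of l j]
        by (simp add: mat_minus_def minus_eq r_distr r_minus l_distr l_minus)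
    qed (use ij m mat_minus_mats[OF assms(1,2), THEN matsD] in auto)
    also have "\<dots> = mat_mult R n (mat_minus R n A B) M i j"
      using ij by (simp add: mat_mult_def)
    finally show "mat_minus R n (mat_mult R n A M) (mat_mult R n B M) i j = mat_mult R n (mat_minus R n A B) M i j" .
  qed (intro mat_mult_mats mat_minus_mats assms)+
qed

lemma biinv_metric_d_rk: "biinv_metric (GL_grp R n) (d_rk R n)"
proof -
  have 1: "d_rk R n A B = 0 \<longleftrightarrow> A = B" if "A \<in> GL R n" "B \<in> GL R n" for A B
  \<comment> \<open>In size 0 the quotient in \<open>d_rk\<close> is a division by 0, hence 0; this
    is consistent because there is only one matrix of that size.\<close>
  proof (cases "n = 0")
    case True
    then have "A = B" using that by (intro mats_eqI[of _ n]) (auto simp: GL_mats)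
    then show ?thesis using True by (simp add: d_rk_def)
  next
    case False
    then show ?thesis using that by (simp add: d_rk_def mat_rank_minus_eq_0_iff GL_mats)
  qed
  have 2: "d_rk R n A B = d_rk R n B A" if "A \<in> GL R n" "B \<in> GL R n" for A B
    unfolding d_rk_def using that by (metis GL_mats mat_rank_minus_commute_le le_antisym)
  have 3: "d_rk R n A C \<le> d_rk R n A B + d_rk R n B C" if "A \<in> GL R n" "B \<in> GL R n" "C \<in> GL R n" for A B C
    using that mat_rank_triangle[of A n B C, THEN of_nat_mono[where 'a = real]]
    by (simp add: d_rk_def GL_mats add_divide_distrib[symmetric] divide_right_mono)
  have 4: "d_rk R n (mat_mult R n C A) (mat_mult R n C B) = d_rk R n A B"
    "d_rk R n (mat_mult R n A C) (mat_mult R n B C) = d_rk R n A B"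
    if "A \<in> GL R n" "B \<in> GL R n" "C \<in> GL R n" for A B C
    using that by (simp_all add: d_rk_def mat_minus_mult mat_rank_mult_GL mat_minus_mats GL_mats)
  show ?thesis unfolding biinv_metric_def GL_grp_def using 1 2 3 4 by auto
qed

end

subsection \<open>Metric ultraproducts\<close>

lemma biinv_metricD:
  assumes "biinv_metric H d" "x \<in> carrier H" "y \<in> carrier H"
  shows "d x y = 0 \<longleftrightarrow> x = y" "d x y = d y x" "0 \<le> d x y"
    "z \<in> carrier H \<Longrightarrow> d x z \<le> d x y + d y z"
    "z \<in> carrier H \<Longrightarrow> d (z \<otimes>\<^bsub>H\<^esub> x) (z \<otimes>\<^bsub>H\<^esub> y) = d x y"
    "z \<in> carrier H \<Longrightarrow> d (x \<otimes>\<^bsub>H\<^esub> z) (y \<otimes>\<^bsub>H\<^esub> z) = d x y"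
proof -
  show 1: "d x y = 0 \<longleftrightarrow> x = y" "d x y = d y x"
    "z \<in> carrier H \<Longrightarrow> d x z \<le> d x y + d y z"
    "z \<in> carrier H \<Longrightarrow> d (z \<otimes>\<^bsub>H\<^esub> x) (z \<otimes>\<^bsub>H\<^esub> y) = d x y"
    "z \<in> carrier H \<Longrightarrow> d (x \<otimes>\<^bsub>H\<^esub> z) (y \<otimes>\<^bsub>H\<^esub> z) = d x y"
    using assms unfolding biinv_metric_def by blast+
  \<comment> \<open>Non-negativity is not among the clauses of \<open>biinv_metric\<close>; the
    triangle inequality through y and symmetry give it.\<close>
  have "d x x = 0" "d x x \<le> d x y + d y x"
    using assms unfolding biinv_metric_def by blast+
  then show "0 \<le> d x y" using 1(2) by simp
qed

locale metric_group_family =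
  fixes H :: "nat \<Rightarrow> ('g, 'm) monoid_scheme" and d :: "nat \<Rightarrow> 'g \<Rightarrow> 'g \<Rightarrow> real"
  assumes group_H: "group (H k)" and biinv: "biinv_metric (H k) (d k)"
begin

lemmas dist = biinv_metricD[OF biinv]

lemma prod_closed: "a \<in> carrier (prod_grp H) \<Longrightarrow> a k \<in> carrier (H k)"
  by (simp add: prod_grp_def)

lemma mult_prod: "(a \<otimes>\<^bsub>prod_grp H\<^esub> b) k = a k \<otimes>\<^bsub>H k\<^esub> b k"
  by (simp add: prod_grp_def)

lemma one_prod: "\<one>\<^bsub>prod_grp H\<^esub> k = \<one>\<^bsub>H k\<^esub>"
  by (simp add: prod_grp_def)

lemma group_prod_grp: "group (prod_grp H)"
proof (rule groupI)
  have m: "Group.monoid (H k)" for k using group_H group.is_monoid by blast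
  fix a assume a: "a \<in> carrier (prod_grp H)"
  show "\<exists>b\<in>carrier (prod_grp H). b \<otimes>\<^bsub>prod_grp H\<^esub> a = \<one>\<^bsub>prod_grp H\<^esub>"
    using a group.l_inv[OF group_H] group.inv_closed[OF group_H]
    by (intro bexI[of _ "\<lambda>k. inv\<^bsub>H k\<^esub> a k"]) (auto simp: prod_grp_def)
next
  have m: "Group.monoid (H k)" for k using group_H group.is_monoid by blast
  show "\<one>\<^bsub>prod_grp H\<^esub> \<in> carrier (prod_grp H)" using Group.monoid.one_closed[OF m] by (simp add: prod_grp_def)
  fix a b c assume "a \<in> carrier (prod_grp H)" "b \<in> carrier (prod_grp H)"
  then show "a \<otimes>\<^bsub>prod_grp H\<^esub> b \<in> carrier (prod_grp H)"
    using Group.monoid.m_closed[OF m] by (simp add: prod_grp_def)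
  assume "c \<in> carrier (prod_grp H)"
  then show "a \<otimes>\<^bsub>prod_grp H\<^esub> b \<otimes>\<^bsub>prod_grp H\<^esub> c = a \<otimes>\<^bsub>prod_grp H\<^esub> (b \<otimes>\<^bsub>prod_grp H\<^esub> c)"
    using \<open>a \<in> _\<close> \<open>b \<in> _\<close> Group.monoid.m_assoc[OF m] by (simp add: prod_grp_def)
next
  have m: "Group.monoid (H k)" for k using group_H group.is_monoid by blast
  fix a assume "a \<in> carrier (prod_grp H)"
  then show "\<one>\<^bsub>prod_grp H\<^esub> \<otimes>\<^bsub>prod_grp H\<^esub> a = a"
    using Group.monoid.l_one[OF m] by (auto simp: prod_grp_def)
qed

interpretation P: group "prod_grp H" by (rule group_prod_grp)

lemma inv_prod: "a \<in> carrier (prod_grp H) \<Longrightarrow> (inv\<^bsub>prod_grp H\<^esub> a) k = inv\<^bsub>H k\<^esub> a k"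
  using P.inv_equality[of "\<lambda>k. inv\<^bsub>H k\<^esub> a k" a] group.l_inv[OF group_H] group.inv_closed[OF group_H]
  by (auto simp: prod_grp_def)

text \<open>Right invariance turns membership of a quotient in the kernel into a statement about the
  distance of its two terms.\<close>

lemma dist_mult_inv:
  assumes "x \<in> carrier (H k)" "y \<in> carrier (H k)"
  shows "d k (x \<otimes>\<^bsub>H k\<^esub> inv\<^bsub>H k\<^esub> y) \<one>\<^bsub>H k\<^esub> = d k x y"
proof -
  interpret K: group "H k" by (rule group_H)
  show ?thesis using dist(6)[of x k y "inv\<^bsub>H k\<^esub> y"] assms by simp
qed

text \<open>Right invariance gives d(ab, 1) \<le> d(ab, b) + d(b, 1) = d(a, 1) + d(b, 1), hence
  closure under products. Invariance on both sides makes the distance to 1 invariant under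
  conjugation, hence normality.\<close>

lemma normal_ultra_kernel: "ultra_kernel \<omega> H d \<lhd> prod_grp H"
proof -
  let ?K = "ultra_kernel \<omega> H d"
  have one: "\<one>\<^bsub>H k\<^esub> \<in> carrier (H k)" for k
    using prod_closed[OF P.one_closed] by (simp add: one_prod)
  have "subgroup ?K (prod_grp H)"
  proof (rule P.subgroupI)
    show "?K \<subseteq> carrier (prod_grp H)" by (auto simp: ultra_kernel_def)
    have "d k \<one>\<^bsub>H k\<^esub> \<one>\<^bsub>H k\<^esub> = 0" for k using dist(1)[OF one one] by simp
    then have "\<one>\<^bsub>prod_grp H\<^esub> \<in> ?K" unfolding ultra_kernel_def by (simp add: one_prod)
    then show "?K \<noteq> {}" by auto
  next
    fix a assume a: "a \<in> ?K"
    then have c: "a \<in> carrier (prod_grp H)" by (auto simp: ultra_kernel_def)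
    have "d k ((inv\<^bsub>prod_grp H\<^esub> a) k) \<one>\<^bsub>H k\<^esub> = d k (a k) \<one>\<^bsub>H k\<^esub>" for k
    proof -
      interpret K: group "H k" by (rule group_H)
      have "d k (\<one>\<^bsub>H k\<^esub> \<otimes>\<^bsub>H k\<^esub> inv\<^bsub>H k\<^esub> a k) \<one>\<^bsub>H k\<^esub> = d k \<one>\<^bsub>H k\<^esub> (a k)"
        using prod_closed[OF c] by (intro dist_mult_inv) auto
      then show ?thesis using prod_closed[OF c] dist(2) by (simp add: inv_prod[OF c])
    qed
    then show "inv\<^bsub>prod_grp H\<^esub> a \<in> ?K" using a by (simp add: ultra_kernel_def)
  next
    fix a b assume a: "a \<in> ?K" and b: "b \<in> ?K"
    then have c: "a \<in> carrier (prod_grp H)" "b \<in> carrier (prod_grp H)" by (auto simp: ultra_kernel_def)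
    have "((\<lambda>k. d k ((a \<otimes>\<^bsub>prod_grp H\<^esub> b) k) \<one>\<^bsub>H k\<^esub>) \<longlongrightarrow> 0) \<omega>"
    proof (rule tendsto_sandwich[of "\<lambda>_. 0"])
      show "((\<lambda>k. d k (a k) \<one>\<^bsub>H k\<^esub> + d k (b k) \<one>\<^bsub>H k\<^esub>) \<longlongrightarrow> 0) \<omega>"
        using a b by (auto simp: ultra_kernel_def intro!: tendsto_eq_intros)
      show "\<forall>\<^sub>F k in \<omega>. 0 \<le> d k ((a \<otimes>\<^bsub>prod_grp H\<^esub> b) k) \<one>\<^bsub>H k\<^esub>"
        using c prod_closed[OF P.m_closed] one by (auto intro!: always_eventually dist(3))
      show "\<forall>\<^sub>F k in \<omega>. d k ((a \<otimes>\<^bsub>prod_grp H\<^esub> b) k) \<one>\<^bsub>H k\<^esub> \<le> d k (a k) \<one>\<^bsub>H k\<^esub> + d k (b k) \<one>\<^bsub>H k\<^esub>"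
      proof (intro always_eventually allI)
        fix k
        interpret K: group "H k" by (rule group_H)
        note ab = c[THEN prod_closed, of k]
        have "d k (a k \<otimes>\<^bsub>H k\<^esub> b k) \<one>\<^bsub>H k\<^esub> \<le> d k (a k \<otimes>\<^bsub>H k\<^esub> b k) (b k) + d k (b k) \<one>\<^bsub>H k\<^esub>"
          using ab by (intro dist(4)) auto
        also have "d k (a k \<otimes>\<^bsub>H k\<^esub> b k) (b k) = d k (a k) \<one>\<^bsub>H k\<^esub>"
          using dist(6)[of "a k" k "\<one>\<^bsub>H k\<^esub>" "b k"] ab by simp
        finally show "d k ((a \<otimes>\<^bsub>prod_grp H\<^esub> b) k) \<one>\<^bsub>H k\<^esub> \<le> d k (a k) \<one>\<^bsub>H k\<^esub> + d k (b k) \<one>\<^bsub>H k\<^esub>"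
          by (simp add: mult_prod)
      qed
    qed simp
    then show "a \<otimes>\<^bsub>prod_grp H\<^esub> b \<in> ?K" using c by (simp add: ultra_kernel_def)
  qed
  moreover have "x \<otimes>\<^bsub>prod_grp H\<^esub> a \<otimes>\<^bsub>prod_grp H\<^esub> inv\<^bsub>prod_grp H\<^esub> x \<in> ?K"
    if x: "x \<in> carrier (prod_grp H)" and a: "a \<in> ?K" for x a
  proof -
    have c: "a \<in> carrier (prod_grp H)" using a by (simp add: ultra_kernel_def)
    have "d k ((x \<otimes>\<^bsub>prod_grp H\<^esub> a \<otimes>\<^bsub>prod_grp H\<^esub> inv\<^bsub>prod_grp H\<^esub> x) k) \<one>\<^bsub>H k\<^esub> = d k (a k) \<one>\<^bsub>H k\<^esub>" for k
    proof -
      interpret K: group "H k" by (rule group_H)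
      note xa = x[THEN prod_closed, of k] c[THEN prod_closed, of k]
      have "d k (x k \<otimes>\<^bsub>H k\<^esub> a k \<otimes>\<^bsub>H k\<^esub> inv\<^bsub>H k\<^esub> x k) \<one>\<^bsub>H k\<^esub> = d k (x k \<otimes>\<^bsub>H k\<^esub> a k) (x k)"
        using xa by (intro dist_mult_inv) auto
      also have "\<dots> = d k (a k) \<one>\<^bsub>H k\<^esub>" using dist(5)[of "a k" k "\<one>\<^bsub>H k\<^esub>" "x k"] xa by simp
      finally show ?thesis using x by (simp add: mult_prod inv_prod)
    qed
    then show ?thesis using a x by (simp add: ultra_kernel_def)
  qed
  ultimately show ?thesis unfolding P.normal_inv_iff by blast
qed

text \<open>This removes cosets from the argument: equality in the ultraproduct is convergence of
  the distances between representatives.\<close>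

lemma ultra_coset_eq_iff:
  assumes a: "a \<in> carrier (prod_grp H)" and b: "b \<in> carrier (prod_grp H)"
  shows "ultra_kernel \<omega> H d #>\<^bsub>prod_grp H\<^esub> a = ultra_kernel \<omega> H d #>\<^bsub>prod_grp H\<^esub> b \<longleftrightarrow>
    ((\<lambda>k. d k (a k) (b k)) \<longlongrightarrow> 0) \<omega>"
proof -
  let ?K = "ultra_kernel \<omega> H d"
  interpret K: normal ?K "prod_grp H" by (rule normal_ultra_kernel)
  have sg: "subgroup ?K (prod_grp H)" by (rule K.subgroup_axioms)
  have "?K #>\<^bsub>prod_grp H\<^esub> a = ?K #>\<^bsub>prod_grp H\<^esub> b \<longleftrightarrow> a \<in> ?K #>\<^bsub>prod_grp H\<^esub> b"
    using P.repr_independence[OF _ b sg] P.rcos_self[OF a sg] by blast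
  also have "\<dots> \<longleftrightarrow> a \<otimes>\<^bsub>prod_grp H\<^esub> inv\<^bsub>prod_grp H\<^esub> b \<in> ?K"
    using K.rcos_module[OF P.group_axioms b a] .
  also have "\<dots> \<longleftrightarrow> ((\<lambda>k. d k (a k) (b k)) \<longlongrightarrow> 0) \<omega>"
  proof -
    have "d k ((a \<otimes>\<^bsub>prod_grp H\<^esub> inv\<^bsub>prod_grp H\<^esub> b) k) \<one>\<^bsub>H k\<^esub> = d k (a k) (b k)" for k
      unfolding mult_prod inv_prod[OF b] by (rule dist_mult_inv[OF prod_closed[OF a] prod_closed[OF b]])
    moreover have "a \<otimes>\<^bsub>prod_grp H\<^esub> inv\<^bsub>prod_grp H\<^esub> b \<in> carrier (prod_grp H)"
      using a b by (intro P.m_closed P.inv_closed)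
    ultimately show ?thesis unfolding ultra_kernel_def mem_Collect_eq by presburger
  qed
  finally show ?thesis .
qed

text \<open>A choice of representatives for an injective morphism into the ultraproduct. At a single
  k it need not be multiplicative; both multiplicativity and injectivity are statements about limits
  of distances, which is what a reduction can preserve.\<close>

definition asymptotic_embedding :: "nat filter \<Rightarrow> ('a, 'b) monoid_scheme \<Rightarrow> ('a \<Rightarrow> nat \<Rightarrow> 'g) \<Rightarrow> bool" where
  "asymptotic_embedding \<omega> G A \<longleftrightarrow>
    (\<forall>g\<in>carrier G. \<forall>k. A g k \<in> carrier (H k)) \<and>
    (\<forall>g\<in>carrier G. \<forall>h\<in>carrier G. ((\<lambda>k. d k (A g k \<otimes>\<^bsub>H k\<^esub> A h k) (A (g \<otimes>\<^bsub>G\<^esub> h) k)) \<longlongrightarrow> 0) \<omega>) \<and>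
    (\<forall>g\<in>carrier G. \<forall>h\<in>carrier G. ((\<lambda>k. d k (A g k) (A h k)) \<longlongrightarrow> 0) \<omega> \<longrightarrow> g = h)"

text \<open>One direction chooses a representative of each coset \<open>\<Phi> g\<close>, the other
  takes cosets; \<open>ultra_coset_eq_iff\<close> translates the clauses.\<close>

lemma embeds_in_metric_ultraproduct_iff:
  assumes "group G"
  shows "(\<exists>\<Phi>. \<Phi> \<in> hom G (metric_ultraproduct \<omega> H d) \<and> inj_on \<Phi> (carrier G)) \<longleftrightarrow>
    (\<exists>A. asymptotic_embedding \<omega> G A)"
proof -
  interpret G: group G by fact
  let ?K = "ultra_kernel \<omega> H d"
  let ?q = "\<lambda>a. ?K #>\<^bsub>prod_grp H\<^esub> a"
  interpret K: normal ?K "prod_grp H" by (rule normal_ultra_kernel)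
  have car: "carrier (metric_ultraproduct \<omega> H d) = ?q ` carrier (prod_grp H)"
    by (auto simp: metric_ultraproduct_def FactGroup_def RCOSETS_def)
  have mult: "?q a \<otimes>\<^bsub>metric_ultraproduct \<omega> H d\<^esub> ?q b = ?q (a \<otimes>\<^bsub>prod_grp H\<^esub> b)"
    if "a \<in> carrier (prod_grp H)" "b \<in> carrier (prod_grp H)" for a b
    using K.rcos_sum[OF that] by (simp add: metric_ultraproduct_def FactGroup_def)
  have mem: "A g \<in> carrier (prod_grp H)" if "\<forall>k. A g k \<in> carrier (H k)" for A :: "'x \<Rightarrow> nat \<Rightarrow> 'g" and g
    using that by (simp add: prod_grp_def)
  show ?thesis
  proof
    assume "\<exists>\<Phi>. \<Phi> \<in> hom G (metric_ultraproduct \<omega> H d) \<and> inj_on \<Phi> (carrier G)"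
    then obtain \<Phi> where \<Phi>: "\<Phi> \<in> hom G (metric_ultraproduct \<omega> H d)" "inj_on \<Phi> (carrier G)" by blast
    have "\<forall>g\<in>carrier G. \<exists>a\<in>carrier (prod_grp H). \<Phi> g = ?q a"
    proof
      fix g assume "g \<in> carrier G"
      then have "\<Phi> g \<in> ?q ` carrier (prod_grp H)" using hom_in_carrier[OF \<Phi>(1)] car by blast
      then show "\<exists>a\<in>carrier (prod_grp H). \<Phi> g = ?q a" by blast
    qed
    then obtain A where A: "\<And>g. g \<in> carrier G \<Longrightarrow> A g \<in> carrier (prod_grp H)"
      "\<And>g. g \<in> carrier G \<Longrightarrow> \<Phi> g = ?q (A g)" by metis
    have "asymptotic_embedding \<omega> G A"
      unfolding asymptotic_embedding_def
    proof (intro conjI ballI allI impI)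
      show "A g k \<in> carrier (H k)" if "g \<in> carrier G" for g k
        using A(1)[OF that] by (rule prod_closed)
    next
      fix g h assume gh: "g \<in> carrier G" "h \<in> carrier G"
      have "?q (A g \<otimes>\<^bsub>prod_grp H\<^esub> A h) = ?q (A (g \<otimes>\<^bsub>G\<^esub> h))"
        using A gh mult[OF A(1)[OF gh(1)] A(1)[OF gh(2)]] hom_mult[OF \<Phi>(1) gh] by simp
      then show "((\<lambda>k. d k (A g k \<otimes>\<^bsub>H k\<^esub> A h k) (A (g \<otimes>\<^bsub>G\<^esub> h) k)) \<longlongrightarrow> 0) \<omega>"
        using A gh by (subst (asm) ultra_coset_eq_iff) (auto simp: mult_prod)
    next
      fix g h assume gh: "g \<in> carrier G" "h \<in> carrier G" and lim: "((\<lambda>k. d k (A g k) (A h k)) \<longlongrightarrow> 0) \<omega>"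
      have "?q (A g) = ?q (A h)" using ultra_coset_eq_iff[OF A(1)[OF gh(1)] A(1)[OF gh(2)]] lim by simp
      then show "g = h" using A gh inj_onD[OF \<Phi>(2)] by simp
    qed
    then show "\<exists>A. asymptotic_embedding \<omega> G A" by blast
  next
    assume "\<exists>A. asymptotic_embedding \<omega> G A"
    then obtain A where emb: "asymptotic_embedding \<omega> G A" by blast
    have A: "A g \<in> carrier (prod_grp H)" if "g \<in> carrier G" for g
      using emb that by (simp add: asymptotic_embedding_def prod_grp_def)
    have "(\<lambda>g. ?q (A g)) \<in> hom G (metric_ultraproduct \<omega> H d)"
    proof (rule homI)
      show "?q (A g) \<in> carrier (metric_ultraproduct \<omega> H d)" if "g \<in> carrier G" for g
        using A[OF that] by (simp add: car)
      fix g h assume gh: "g \<in> carrier G" "h \<in> carrier G"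
      have "?q (A g \<otimes>\<^bsub>prod_grp H\<^esub> A h) = ?q (A (g \<otimes>\<^bsub>G\<^esub> h))"
        using A gh emb by (subst ultra_coset_eq_iff) (auto simp: mult_prod asymptotic_embedding_def)
      then show "?q (A (g \<otimes>\<^bsub>G\<^esub> h)) = ?q (A g) \<otimes>\<^bsub>metric_ultraproduct \<omega> H d\<^esub> ?q (A h)"
        using mult[OF A[OF gh(1)] A[OF gh(2)]] by simp
    qed
    moreover have "inj_on (\<lambda>g. ?q (A g)) (carrier G)"
    proof (rule inj_onI)
      fix g h assume gh: "g \<in> carrier G" "h \<in> carrier G" "?q (A g) = ?q (A h)"
      then show "g = h" using ultra_coset_eq_iff[OF A[OF gh(1)] A[OF gh(2)]] emb
        by (simp add: asymptotic_embedding_def)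
    qed
    ultimately show "\<exists>\<Phi>. \<Phi> \<in> hom G (metric_ultraproduct \<omega> H d) \<and> inj_on \<Phi> (carrier G)" by blast
  qed
qed

end

subsection \<open>Reduction of complex matrices\<close>

lemma field_complex_field: "field complex_field"
proof -
  have ab: "abelian_group complex_field"
    by (rule abelian_groupI) (auto simp: complex_field_def intro: exI[of _ "- x" for x])
  have "Group.comm_monoid complex_field"
    by (rule Group.comm_monoidI) (auto simp: complex_field_def)
  with ab have "cring complex_field"
    by (rule cringI) (auto simp: complex_field_def distrib_right)
  then interpret cring complex_field .
  show ?thesis
  proof (rule cring_fieldI)
    have "x \<in> Units complex_field" if "x \<noteq> 0" for x
      unfolding Units_def using that
      by (auto simp: complex_field_def intro!: exI[of _ "inverse x"])
    moreover have "0 \<notin> Units complex_field"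
      by (auto simp: Units_def complex_field_def)
    ultimately show "Units complex_field = carrier complex_field - {\<zero>\<^bsub>complex_field\<^esub>}"
      by (auto simp: complex_field_def)
  qed
qed

interpretation CF: field complex_field
  rewrites "carrier complex_field = UNIV" and "monoid.mult complex_field = (*)" and "add complex_field = (+)"
    and "one complex_field = 1" and "zero complex_field = 0"
  by (rule field_complex_field) (simp_all add: complex_field_def)

lemma complex_field_simps [simp]:
  "carrier complex_field = UNIV" "monoid.mult complex_field = (*)" "add complex_field = (+)"
  "one complex_field = 1" "zero complex_field = 0"
  by (simp_all add: complex_field_def)

lemma finsum_complex_field [simp]: "finsum complex_field f S = sum f S"
proof (induction S rule: infinite_finite_induct)
  case (infinite S)
  then show ?case by (simp add: CF.finsum_infinite)
next
  case empty
  then show ?case by (simp add: CF.finsum_empty)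
next
  case (insert x S)
  then show ?case by (simp add: CF.finsum_insert)
qed

lemma minus_complex_field [simp]: "x \<ominus>\<^bsub>complex_field\<^esub> y = x - y"
proof -
  have "\<ominus>\<^bsub>complex_field\<^esub> y = - y" using CF.minus_equality[of "- y" y] by simp
  then show ?thesis by (simp add: a_minus_def)
qed

lemma lin_indep_cols_complex:
  "lin_indep_cols complex_field n A S \<longleftrightarrow>
    (\<forall>c. (\<forall>i<n. (\<Sum>j\<in>S. c j * A i j) = 0) \<longrightarrow> (\<forall>j\<in>S. c j = 0))"
  by (simp add: lin_indep_cols_def)

text \<open>Independence quantifies over all coefficient vectors and cannot be read off in a
  subring; a left inverse of the chosen columns certifies it by finitely many numbers. It is built
  column by column.\<close>

lemma lin_indep_cols_left_inverse:
  assumes "finite S" "lin_indep_cols complex_field n A S"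
  shows "\<exists>L. \<forall>k\<in>S. \<forall>j\<in>S. (\<Sum>i<n. L k i * A i j) = (if k = j then 1 else 0)"
  using assms
proof (induction S)
  case empty
  then show ?case by simp
next
  case (insert m S)
  have ind: "(\<And>i. i < n \<Longrightarrow> c m * A i m + (\<Sum>j\<in>S. c j * A i j) = 0) \<Longrightarrow> c m = 0 \<and> (\<forall>j\<in>S. c j = 0)" for c
    using insert.prems insert.hyps unfolding lin_indep_cols_complex by simp
  have "lin_indep_cols complex_field n A S"
    unfolding lin_indep_cols_complex
  proof (intro allI impI)
    fix c assume c: "\<forall>i<n. (\<Sum>j\<in>S. c j * A i j) = 0"
    define c' where "c' = c(m := 0)"
    have c': "c' m = 0" "\<And>j. j \<in> S \<Longrightarrow> c' j = c j" using insert.hyps by (auto simp: c'_def)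
    have "c' m * A i m + (\<Sum>j\<in>S. c' j * A i j) = 0" if "i < n" for i
      using c that by (simp add: c')
    from ind[OF this] show "\<forall>j\<in>S. c j = 0" by (simp add: c')
  qed
  then obtain L where L: "\<And>k j. k \<in> S \<Longrightarrow> j \<in> S \<Longrightarrow> (\<Sum>i<n. L k i * A i j) = (if k = j then 1 else 0)"
    using insert.IH by blast
  define t where "t k = (\<Sum>i<n. L k i * A i m)" for k
  \<comment> \<open>What remains of the column m after subtracting the combination of the columns in
    S suggested by L. It is non-zero by independence, so some entry w p can serve as a
    pivot.\<close>
  define w where "w i = A i m - (\<Sum>k\<in>S. t k * A i k)" for i
  have "\<exists>i<n. w i \<noteq> 0"
  proof (rule ccontr)
    assume "\<not> ?thesis"
    moreover have "(\<Sum>j\<in>S. (\<lambda>j. if j = m then 1 else - t j) j * A i j) = - (\<Sum>k\<in>S. t k * A i k)" for i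
      unfolding sum_negf[symmetric] using insert.hyps by (intro sum.cong) auto
    ultimately show False using ind[of "\<lambda>j. if j = m then 1 else - t j"] by (simp add: w_def)
  qed
  then obtain p where p: "p < n" "w p \<noteq> 0" by blast
  \<comment> \<open>Row p of the identity minus the product of the columns in S with L. It
    annihilates these columns and takes the value w p on the column m, so division by w p yields the
    new row M of the left inverse.\<close>
  define N where "N i = (if i = p then 1 else 0) - (\<Sum>k\<in>S. A p k * L k i)" for i
  define M where "M i = N i / w p" for i
  have M: "(\<Sum>i<n. M i * A i j) = (A p j - (\<Sum>k\<in>S. A p k * (\<Sum>i<n. L k i * A i j))) / w p" for j
  proof -
    have "(\<Sum>i<n. N i * A i j) = (\<Sum>i<n. (if i = p then A i j else 0) - (\<Sum>k\<in>S. A p k * (L k i * A i j)))"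
      by (intro sum.cong) (auto simp: N_def left_diff_distrib sum_distrib_right mult.assoc)
    also have "\<dots> = A p j - (\<Sum>k\<in>S. A p k * (\<Sum>i<n. L k i * A i j))"
    proof -
      have "(\<Sum>i<n. \<Sum>k\<in>S. A p k * (L k i * A i j)) = (\<Sum>k\<in>S. A p k * (\<Sum>i<n. L k i * A i j))"
        by (subst sum.swap) (simp add: sum_distrib_left)
      then show ?thesis using p(1) by (simp add: sum_subtractf)
    qed
    finally show ?thesis by (simp add: M_def sum_divide_distrib[symmetric])
  qed
  have MS: "(\<Sum>i<n. M i * A i j) = 0" if "j \<in> S" for j
  proof -
    have "(\<Sum>k\<in>S. A p k * (\<Sum>i<n. L k i * A i j)) = (\<Sum>k\<in>S. if k = j then A p k else 0)"
      using that by (intro sum.cong) (auto simp: L)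
    then show ?thesis using that insert.hyps by (simp add: M)
  qed
  have "A p m - (\<Sum>k\<in>S. A p k * (\<Sum>i<n. L k i * A i m)) = w p"
    by (simp add: w_def t_def mult.commute)
  then have Mm: "(\<Sum>i<n. M i * A i m) = 1" using p by (simp add: M)
  \<comment> \<open>The old rows have the value t k on the column m; subtracting t k times M
    corrects this and changes nothing on S.\<close>
  define L' where "L' k i = (if k = m then M i else L k i - t k * M i)" for k i
  have "(\<Sum>i<n. L' k i * A i j) = (if k = j then 1 else 0)" if kj: "k \<in> insert m S" "j \<in> insert m S" for k j
  proof (cases "k = m")
    case True
    then show ?thesis using kj MS Mm insert.hyps by (auto simp: L'_def)
  next
    case False
    then have "(\<Sum>i<n. L' k i * A i j) = (\<Sum>i<n. L k i * A i j) - t k * (\<Sum>i<n. M i * A i j)"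
      by (simp add: L'_def left_diff_distrib sum_subtractf sum_distrib_left mult.assoc)
    then show ?thesis using False kj MS Mm L insert.hyps by (auto simp: t_def)
  qed
  then show ?case by blast
qed

text \<open>Truth for every reduction that controls some finite set of complex numbers. The notion
  is closed under finite conjunctions, so the sets of certificates need not be tracked; a reduction
  is chosen only once, in \<open>generically_holds\<close>, after all requirements have been
  combined.\<close>

definition generically :: "(nat ring \<Rightarrow> (complex \<Rightarrow> nat) \<Rightarrow> bool) \<Rightarrow> bool" where
  "generically P \<longleftrightarrow> (\<exists>X. finite X \<and> (\<forall>R F \<phi>. reduction X R F \<phi> \<longrightarrow> P F \<phi>))"

lemma genericallyI:
  "finite X \<Longrightarrow> (\<And>R F \<phi>. reduction X R F \<phi> \<Longrightarrow> P F \<phi>) \<Longrightarrow> generically P"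
  unfolding generically_def by blast

lemma reduction_subset: "reduction Y R F \<phi> \<Longrightarrow> X \<subseteq> Y \<Longrightarrow> reduction X R F \<phi>"
  unfolding reduction_def by blast

lemma generically_conj:
  assumes "generically P" "generically Q"
  shows "generically (\<lambda>F \<phi>. P F \<phi> \<and> Q F \<phi>)"
proof -
  obtain X Y where X: "finite X" "\<And>R F \<phi>. reduction X R F \<phi> \<Longrightarrow> P F \<phi>"
    and Y: "finite Y" "\<And>R F \<phi>. reduction Y R F \<phi> \<Longrightarrow> Q F \<phi>"
    using assms unfolding generically_def by blast
  have "P F \<phi> \<and> Q F \<phi>" if "reduction (X \<union> Y) R F \<phi>" for R F \<phi>
    using X(2)[OF reduction_subset[OF that]] Y(2)[OF reduction_subset[OF that]] by simp
  then show ?thesis unfolding generically_def using X(1) Y(1) by (meson finite_UnI)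
qed

lemma generically_mono:
  assumes "generically P" "\<And>F \<phi>. P F \<phi> \<Longrightarrow> Q F \<phi>"
  shows "generically Q"
  using assms unfolding generically_def by metis

lemma generically_ball:
  assumes "finite S" "\<And>s. s \<in> S \<Longrightarrow> generically (P s)"
  shows "generically (\<lambda>F \<phi>. \<forall>s\<in>S. P s F \<phi>)"
  using assms
proof (induction S)
  case empty
  then show ?case by (intro genericallyI[of "{}"]) simp_all
next
  case (insert s S)
  then have "generically (\<lambda>F \<phi>. P s F \<phi> \<and> (\<forall>s\<in>S. P s F \<phi>))" by (intro generically_conj) auto
  then show ?case by simp
qed

lemma reductionD:
  assumes "reduction X R F \<phi>"
  shows "X \<subseteq> R" "subring_of R" "field F" "finite (carrier F)" "x \<in> R \<Longrightarrow> \<phi> x \<in> carrier F"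
    "\<phi> 0 = \<zero>\<^bsub>F\<^esub>" "\<phi> 1 = \<one>\<^bsub>F\<^esub>" "x \<in> R \<Longrightarrow> y \<in> R \<Longrightarrow> \<phi> (x + y) = \<phi> x \<oplus>\<^bsub>F\<^esub> \<phi> y"
    "x \<in> R \<Longrightarrow> y \<in> R \<Longrightarrow> \<phi> (x * y) = \<phi> x \<otimes>\<^bsub>F\<^esub> \<phi> y" "x \<in> X \<Longrightarrow> x \<noteq> 0 \<Longrightarrow> \<phi> x \<noteq> \<zero>\<^bsub>F\<^esub>"
  using assms by (auto simp: reduction_def)

lemma generically_holds:
  assumes "generically P"
  shows "\<exists>F \<phi>. field F \<and> finite (carrier F) \<and> P F \<phi>"
proof -
  obtain X where X: "finite X" "\<And>R F \<phi>. reduction X R F \<phi> \<Longrightarrow> P F \<phi>"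
    using assms unfolding generically_def by blast
  obtain R F \<phi> where h: "reduction X R F \<phi>" using exists_reduction[OF X(1)] by blast
  show ?thesis using X(2)[OF h] reductionD(3,4)[OF h] by (intro exI[of _ F] exI[of _ \<phi>]) simp
qed

lemma reduction_sum:
  assumes h: "reduction X R F \<phi>" and f: "\<And>s. s \<in> S \<Longrightarrow> f s \<in> R" and "finite S"
  shows "\<phi> (\<Sum>s\<in>S. f s) = (\<Oplus>\<^bsub>F\<^esub>s\<in>S. \<phi> (f s))"
  using \<open>finite S\<close> f
proof (induction S)
  interpret F: field F by (rule reductionD(3)[OF h])
  interpret R: subring_of R by (rule reductionD(2)[OF h])
  case empty
  show ?case by (simp add: reductionD(6)[OF h] F.finsum_empty)
next
  interpret F: field F by (rule reductionD(3)[OF h])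
  interpret R: subring_of R by (rule reductionD(2)[OF h])
  case (insert x S)
  have "(\<Sum>s\<in>S. f s) \<in> R" using insert by (intro R.sum_mem) auto
  then have "\<phi> (\<Sum>s\<in>insert x S. f s) = \<phi> (f x) \<oplus>\<^bsub>F\<^esub> (\<Oplus>\<^bsub>F\<^esub>s\<in>S. \<phi> (f s))"
    using insert by (simp add: reductionD(8)[OF h])
  also have "\<dots> = (\<Oplus>\<^bsub>F\<^esub>s\<in>insert x S. \<phi> (f s))"
    using insert by (intro F.finsum_insert[symmetric]) (auto simp: reductionD(5)[OF h])
  finally show ?case .
qed

lemma reduction_diff:
  assumes h: "reduction X R F \<phi>" and "x \<in> R" "y \<in> R"
  shows "\<phi> (x - y) = \<phi> x \<ominus>\<^bsub>F\<^esub> \<phi> y"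
proof -
  interpret F: field F by (rule reductionD(3)[OF h])
  interpret R: subring_of R by (rule reductionD(2)[OF h])
  have "\<phi> (- y) \<oplus>\<^bsub>F\<^esub> \<phi> y = \<zero>\<^bsub>F\<^esub>"
    using assms reductionD(8)[OF h, of "- y" y] by (simp add: reductionD(6)[OF h])
  then have "\<ominus>\<^bsub>F\<^esub> \<phi> y = \<phi> (- y)"
    using assms by (intro F.minus_equality) (auto simp: reductionD(5)[OF h])
  then show ?thesis using assms reductionD(8)[OF h, of x "- y"] by (simp add: a_minus_def)
qed

section \<open>Transfer of independence, rank, invertibility and distance\<close>

definition map_mat :: "('a \<Rightarrow> 'b) \<Rightarrow> (nat \<Rightarrow> nat \<Rightarrow> 'a) \<Rightarrow> nat \<Rightarrow> nat \<Rightarrow> 'b" where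
  "map_mat \<phi> A = (\<lambda>i j. \<phi> (A i j))"

text \<open>Both answers need a certificate: independence is carried over by the equations of a left
  inverse, dependence by a relation whose non-zero coefficient is kept non-zero.\<close>

lemma lin_indep_cols_transfer:
  assumes "finite S"
  shows "generically (\<lambda>F \<phi>. lin_indep_cols F n (map_mat \<phi> A) S \<longleftrightarrow> lin_indep_cols complex_field n A S)"
proof (cases "lin_indep_cols complex_field n A S")
  case True
  obtain L where L: "\<And>k j. k \<in> S \<Longrightarrow> j \<in> S \<Longrightarrow> (\<Sum>i<n. L k i * A i j) = (if k = j then 1 else 0)"
    using lin_indep_cols_left_inverse[OF assms True] by blast
  define X where "X = (\<lambda>(k, i). L k i) ` (S \<times> {..<n}) \<union> (\<lambda>(i, j). A i j) ` ({..<n} \<times> S)"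
  have "lin_indep_cols F n (map_mat \<phi> A) S" if h: "reduction X R F \<phi>" for R F \<phi>
    unfolding lin_indep_cols_def map_mat_def
  proof (intro allI impI ballI)
    interpret F: field F by (rule reductionD(3)[OF h])
    interpret R: subring_of R by (rule reductionD(2)[OF h])
    have LR: "L k i \<in> R" if "k \<in> S" "i < n" for k i
      using that reductionD(1)[OF h] by (auto simp: X_def)
    have AR: "A i j \<in> R" if "i < n" "j \<in> S" for i j
      using that reductionD(1)[OF h] by (auto simp: X_def)
    note F = reductionD(5)[OF h]
    fix c k assume c: "\<forall>j\<in>S. c j \<in> carrier F" "\<forall>i<n. (\<Oplus>\<^bsub>F\<^esub>j\<in>S. c j \<otimes>\<^bsub>F\<^esub> \<phi> (A i j)) = \<zero>\<^bsub>F\<^esub>" and k: "k \<in> S"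
    have inv: "(\<Oplus>\<^bsub>F\<^esub>i\<in>{..<n}. \<phi> (L k i) \<otimes>\<^bsub>F\<^esub> \<phi> (A i j)) = (if k = j then \<one>\<^bsub>F\<^esub> else \<zero>\<^bsub>F\<^esub>)" if j: "j \<in> S" for j
    proof -
      have "\<phi> (\<Sum>i<n. L k i * A i j) = (\<Oplus>\<^bsub>F\<^esub>i\<in>{..<n}. \<phi> (L k i * A i j))"
        using k j LR AR by (intro reduction_sum[OF h]) auto
      also have "\<dots> = (\<Oplus>\<^bsub>F\<^esub>i\<in>{..<n}. \<phi> (L k i) \<otimes>\<^bsub>F\<^esub> \<phi> (A i j))"
        using k j LR AR F by (intro F.finsum_cong') (auto simp: reductionD(9)[OF h])
      finally have "(\<Oplus>\<^bsub>F\<^esub>i\<in>{..<n}. \<phi> (L k i) \<otimes>\<^bsub>F\<^esub> \<phi> (A i j)) = \<phi> (if k = j then 1 else 0)"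
        unfolding L[OF k j] by (rule sym)
      then show ?thesis using reductionD(6,7)[OF h] by (cases "k = j") simp_all
    qed
    \<comment> \<open>The reduced left inverse recovers c from the product of the reduced matrix
      with c: c = (L A) c = L (A c) = 0.\<close>
    have "c k = (\<Oplus>\<^bsub>F\<^esub>j\<in>S. if k = j then c j else \<zero>\<^bsub>F\<^esub>)"
      using k c assms by (intro F.finsum_singleton[symmetric]) auto
    also have "\<dots> = (\<Oplus>\<^bsub>F\<^esub>j\<in>S. (\<Oplus>\<^bsub>F\<^esub>i\<in>{..<n}. \<phi> (L k i) \<otimes>\<^bsub>F\<^esub> \<phi> (A i j)) \<otimes>\<^bsub>F\<^esub> c j)"
      using c by (intro F.finsum_cong') (auto simp: inv)
    also have "\<dots> = (\<Oplus>\<^bsub>F\<^esub>i\<in>{..<n}. \<phi> (L k i) \<otimes>\<^bsub>F\<^esub> (\<Oplus>\<^bsub>F\<^esub>j\<in>S. \<phi> (A i j) \<otimes>\<^bsub>F\<^esub> c j))"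
      using c k LR AR F assms by (intro F.finsum_matrix_assoc) auto
    also have "\<dots> = \<zero>\<^bsub>F\<^esub>"
    proof (rule F.add.finprod_one_eqI)
      fix i assume i: "i \<in> {..<n}"
      have "(\<Oplus>\<^bsub>F\<^esub>j\<in>S. \<phi> (A i j) \<otimes>\<^bsub>F\<^esub> c j) = (\<Oplus>\<^bsub>F\<^esub>j\<in>S. c j \<otimes>\<^bsub>F\<^esub> \<phi> (A i j))"
        using c AR F i by (intro F.finsum_cong') (auto simp: F.m_comm)
      then show "\<phi> (L k i) \<otimes>\<^bsub>F\<^esub> (\<Oplus>\<^bsub>F\<^esub>j\<in>S. \<phi> (A i j) \<otimes>\<^bsub>F\<^esub> c j) = \<zero>\<^bsub>F\<^esub>"
        using c i k LR F by simp
    qed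
    finally show "c k = \<zero>\<^bsub>F\<^esub>" .
  qed
  moreover have "finite X" using assms by (simp add: X_def)
  ultimately show ?thesis using True unfolding generically_def by blast
next
  case False
  then obtain c k where c: "\<And>i. i < n \<Longrightarrow> (\<Sum>j\<in>S. c j * A i j) = 0" "k \<in> S" "c k \<noteq> 0"
    unfolding lin_indep_cols_complex by blast
  \<comment> \<open>Putting the coefficients into X guarantees that c k does not become 0.\<close>
  define X where "X = c ` S \<union> (\<lambda>(i, j). A i j) ` ({..<n} \<times> S)"
  have "\<not> lin_indep_cols F n (map_mat \<phi> A) S" if h: "reduction X R F \<phi>" for R F \<phi>
  proof
    interpret F: field F by (rule reductionD(3)[OF h])
    interpret R: subring_of R by (rule reductionD(2)[OF h])
    have cR: "c j \<in> R" if "j \<in> S" for j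
      using that reductionD(1)[OF h] by (auto simp: X_def)
    have AR: "A i j \<in> R" if "i < n" "j \<in> S" for i j
      using that reductionD(1)[OF h] by (auto simp: X_def)
    note F = reductionD(5)[OF h]
    assume *: "lin_indep_cols F n (map_mat \<phi> A) S"
    have "(\<Oplus>\<^bsub>F\<^esub>j\<in>S. \<phi> (c j) \<otimes>\<^bsub>F\<^esub> \<phi> (A i j)) = \<zero>\<^bsub>F\<^esub>" if i: "i < n" for i
    proof -
      have "(\<Oplus>\<^bsub>F\<^esub>j\<in>S. \<phi> (c j) \<otimes>\<^bsub>F\<^esub> \<phi> (A i j)) = (\<Oplus>\<^bsub>F\<^esub>j\<in>S. \<phi> (c j * A i j))"
        using i cR AR F by (intro F.finsum_cong') (auto simp: reductionD(9)[OF h])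
      also have "\<dots> = \<phi> (\<Sum>j\<in>S. c j * A i j)"
        using i cR AR assms by (intro reduction_sum[OF h, symmetric]) auto
      finally show ?thesis using c i by (simp add: reductionD(6)[OF h])
    qed
    then have sums: "\<forall>i<n. (\<Oplus>\<^bsub>F\<^esub>j\<in>S. \<phi> (c j) \<otimes>\<^bsub>F\<^esub> \<phi> (A i j)) = \<zero>\<^bsub>F\<^esub>" by blast
    have "\<forall>j\<in>S. \<phi> (c j) \<in> carrier F" by (intro ballI F cR)
    then have "\<forall>j\<in>S. \<phi> (c j) = \<zero>\<^bsub>F\<^esub>"
      by (rule *[unfolded lin_indep_cols_def map_mat_def, THEN spec, THEN mp, THEN mp, OF _ sums])
    then have "\<phi> (c k) = \<zero>\<^bsub>F\<^esub>" using c(2) by blast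
    moreover have "c k \<in> X" using c by (simp add: X_def)
    ultimately show False using reductionD(10)[OF h] c(3) by blast
  qed
  moreover have "finite X" using assms by (simp add: X_def)
  ultimately show ?thesis using False unfolding generically_def by blast
qed

text \<open>The rank depends only on which of the finitely many sets of columns are
  independent.\<close>

lemma mat_rank_transfer:
  "generically (\<lambda>F \<phi>. mat_rank F n (map_mat \<phi> A) = mat_rank complex_field n A)"
proof -
  have "generically (\<lambda>F \<phi>. \<forall>S\<in>Pow {..<n}.
      lin_indep_cols F n (map_mat \<phi> A) S \<longleftrightarrow> lin_indep_cols complex_field n A S)"
    by (intro generically_ball lin_indep_cols_transfer) (auto intro: finite_subset)
  then show ?thesis
  proof (rule generically_mono)
    fix F \<phi>
    assume *: "\<forall>S\<in>Pow {..<n}. lin_indep_cols F n (map_mat \<phi> A) S \<longleftrightarrow> lin_indep_cols complex_field n A S"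
    have "{card S | S. S \<subseteq> {..<n} \<and> lin_indep_cols F n (map_mat \<phi> A) S} =
        {card S | S. S \<subseteq> {..<n} \<and> lin_indep_cols complex_field n A S}"
      using * by auto
    then show "mat_rank F n (map_mat \<phi> A) = mat_rank complex_field n A"
      by (simp add: mat_rank_def)
  qed
qed

definition entries :: "nat \<Rightarrow> (nat \<Rightarrow> nat \<Rightarrow> 'a) \<Rightarrow> 'a set" where
  "entries n A = (\<lambda>(i, j). A i j) ` ({..<n} \<times> {..<n})"

lemma finite_entries [simp]: "finite (entries n A)"
  by (simp add: entries_def)

lemma entries_mem: "entries n A \<subseteq> R \<Longrightarrow> i < n \<Longrightarrow> j < n \<Longrightarrow> A i j \<in> R"
  by (auto simp: entries_def)

lemma reduction_mat_mult:
  assumes h: "reduction X R F \<phi>" and AB: "entries n A \<subseteq> R" "entries n B \<subseteq> R"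
  shows "mat_mult F n (map_mat \<phi> A) (map_mat \<phi> B) = map_mat \<phi> (mat_mult complex_field n A B)"
    "entries n (mat_mult complex_field n A B) \<subseteq> R"
proof -
  interpret F: field F by (rule reductionD(3)[OF h])
  interpret R: subring_of R by (rule reductionD(2)[OF h])
  note m = AB[THEN entries_mem]
  show "entries n (mat_mult complex_field n A B) \<subseteq> R"
    using m by (auto simp: entries_def mat_mult_def intro!: R.sum_mem)
  have "(\<Oplus>\<^bsub>F\<^esub>l\<in>{..<n}. \<phi> (A i l) \<otimes>\<^bsub>F\<^esub> \<phi> (B l j)) = \<phi> (\<Sum>l<n. A i l * B l j)" if "i < n" "j < n" for i j
  proof -
    have "(\<Oplus>\<^bsub>F\<^esub>l\<in>{..<n}. \<phi> (A i l) \<otimes>\<^bsub>F\<^esub> \<phi> (B l j)) = (\<Oplus>\<^bsub>F\<^esub>l\<in>{..<n}. \<phi> (A i l * B l j))"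
      using m that by (intro F.finsum_cong') (auto simp: reductionD(9)[OF h] reductionD(5)[OF h])
    also have "\<dots> = \<phi> (\<Sum>l<n. A i l * B l j)"
      using m that by (intro reduction_sum[OF h, symmetric]) auto
    finally show ?thesis .
  qed
  then show "mat_mult F n (map_mat \<phi> A) (map_mat \<phi> B) = map_mat \<phi> (mat_mult complex_field n A B)"
    by (intro ext) (simp add: mat_mult_def map_mat_def reductionD(6)[OF h])
qed

lemma reduction_mat_minus:
  assumes h: "reduction X R F \<phi>" and AB: "entries n A \<subseteq> R" "entries n B \<subseteq> R"
  shows "mat_minus F n (map_mat \<phi> A) (map_mat \<phi> B) = map_mat \<phi> (mat_minus complex_field n A B)"
  using entries_mem[OF AB(1)] entries_mem[OF AB(2)] reduction_diff[OF h]
  by (intro ext) (simp add: mat_minus_def map_mat_def reductionD(6)[OF h])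

lemma reduction_mats:
  assumes h: "reduction X R F \<phi>" and A: "A \<in> mats complex_field n" "entries n A \<subseteq> R"
  shows "map_mat \<phi> A \<in> mats F n"
  using A(1) entries_mem[OF A(2)] reductionD(5,6)[OF h] by (auto simp: mats_def map_mat_def)

text \<open>The inverse is reduced together with A, so the two equations expressing invertibility
  carry over.\<close>

lemma GL_transfer:
  assumes A: "A \<in> GL complex_field n"
  shows "generically (\<lambda>F \<phi>. map_mat \<phi> A \<in> GL F n)"
proof -
  obtain B where B: "A \<in> mats complex_field n" "B \<in> mats complex_field n"
    "mat_mult complex_field n A B = mat_one complex_field n" "mat_mult complex_field n B A = mat_one complex_field n"
    using A by (auto simp: GL_def)
  have "map_mat \<phi> A \<in> GL F n" if h: "reduction (entries n A \<union> entries n B) R F \<phi>" for R F \<phi>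
  proof -
    have sub: "entries n A \<subseteq> R" "entries n B \<subseteq> R" using reductionD(1)[OF h] by auto
    have one: "map_mat \<phi> (mat_one complex_field n) = mat_one F n"
      by (intro ext) (simp add: map_mat_def mat_one_def reductionD(6,7)[OF h])
    show ?thesis unfolding GL_def
      using reduction_mats[OF h B(1) sub(1)] reduction_mats[OF h B(2) sub(2)]
        reduction_mat_mult(1)[OF h sub] reduction_mat_mult(1)[OF h sub(2,1)]
      by (auto simp: B(3,4) one)
  qed
  then show ?thesis by (intro genericallyI[of "entries n A \<union> entries n B"]) simp_all
qed

lemma d_rk_transfer:
  "generically (\<lambda>F \<phi>. d_rk F n (map_mat \<phi> A) (map_mat \<phi> C) = d_rk complex_field n A C)"
proof -
  have "generically (\<lambda>F \<phi>. mat_minus F n (map_mat \<phi> A) (map_mat \<phi> C) = map_mat \<phi> (mat_minus complex_field n A C))"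
  proof (rule genericallyI[of "entries n A \<union> entries n C"])
    fix R F \<phi> assume h: "reduction (entries n A \<union> entries n C) R F \<phi>"
    show "mat_minus F n (map_mat \<phi> A) (map_mat \<phi> C) = map_mat \<phi> (mat_minus complex_field n A C)"
      using reductionD(1)[OF h] by (intro reduction_mat_minus[OF h]) simp_all
  qed simp
  from generically_conj[OF this mat_rank_transfer[of n "mat_minus complex_field n A C"]]
  show ?thesis by (rule generically_mono) (simp add: d_rk_def)
qed

lemma d_rk_mult_transfer:
  "generically (\<lambda>F \<phi>. d_rk F n (mat_mult F n (map_mat \<phi> A) (map_mat \<phi> B)) (map_mat \<phi> C) =
    d_rk complex_field n (mat_mult complex_field n A B) C)"
proof -
  have "generically (\<lambda>F \<phi>. mat_mult F n (map_mat \<phi> A) (map_mat \<phi> B) = map_mat \<phi> (mat_mult complex_field n A B))"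
  proof (rule genericallyI[of "entries n A \<union> entries n B"])
    fix R F \<phi> assume h: "reduction (entries n A \<union> entries n B) R F \<phi>"
    show "mat_mult F n (map_mat \<phi> A) (map_mat \<phi> B) = map_mat \<phi> (mat_mult complex_field n A B)"
      using reductionD(1)[OF h] by (intro reduction_mat_mult(1)[OF h]) simp_all
  qed simp
  from generically_conj[OF this d_rk_transfer[of n "mat_mult complex_field n A B" C]]
  show ?thesis by (rule generically_mono) simp
qed

subsection \<open>Finite groups and finite fields\<close>

lemma finite_GL:
  assumes "finite (carrier R)"
  shows "finite (GL R n)"
proof -
  define T where "T = {f. \<forall>x. (x \<in> {..<n} \<times> {..<n} \<longrightarrow> f x \<in> carrier R) \<and>
    (x \<notin> {..<n} \<times> {..<n} \<longrightarrow> f x = \<zero>\<^bsub>R\<^esub>)}"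
  have "finite T" unfolding T_def using assms by (intro finite_set_of_finite_funs) auto
  moreover have "GL R n \<subseteq> curry ` T"
  proof
    fix A assume "A \<in> GL R n"
    then have "A \<in> mats R n" by (simp add: GL_def)
    then have "case_prod A \<in> T" by (auto simp: T_def mats_def)
    then show "A \<in> curry ` T" by (intro image_eqI[of _ _ "case_prod A"]) auto
  qed
  ultimately show ?thesis using finite_surj by blast
qed

lemma GL_grp_simps:
  "carrier (GL_grp R n) = GL R n" "monoid.mult (GL_grp R n) = mat_mult R n" "\<one>\<^bsub>GL_grp R n\<^esub> = mat_one R n"
  by (simp_all add: GL_grp_def)

text \<open>\<open>weakly_sofic\<close> asks for groups of natural numbers, whereas matrices are
  functions. The elements of H are numbered and the operation is carried along;
  \<open>nat_copy_dist\<close> does the same for the metric.\<close>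

definition nat_copy :: "('g, 'm) monoid_scheme \<Rightarrow> nat monoid" where
  "nat_copy H = (let e = to_nat_on (carrier H); e' = inv_into (carrier H) e in
     \<lparr>carrier = e ` carrier H, monoid.mult = (\<lambda>a b. e (e' a \<otimes>\<^bsub>H\<^esub> e' b)), one = e \<one>\<^bsub>H\<^esub>\<rparr>)"

definition nat_copy_dist :: "('g, 'm) monoid_scheme \<Rightarrow> ('g \<Rightarrow> 'g \<Rightarrow> real) \<Rightarrow> nat \<Rightarrow> nat \<Rightarrow> real" where
  "nat_copy_dist H d = (let e' = inv_into (carrier H) (to_nat_on (carrier H)) in (\<lambda>a b. d (e' a) (e' b)))"

context
  fixes H :: "('g, 'm) monoid_scheme" and e
  assumes countable_H: "countable (carrier H)"
  defines "e \<equiv> to_nat_on (carrier H)"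
begin

lemma inv_into_encode: "x \<in> carrier H \<Longrightarrow> inv_into (carrier H) e (e x) = x"
  unfolding e_def using countable_H by (simp add: inv_into_f_f inj_on_to_nat_on)

lemma nat_copy_simps:
  "carrier (nat_copy H) = e ` carrier H"
  "x \<in> carrier H \<Longrightarrow> y \<in> carrier H \<Longrightarrow> e x \<otimes>\<^bsub>nat_copy H\<^esub> e y = e (x \<otimes>\<^bsub>H\<^esub> y)"
  "\<one>\<^bsub>nat_copy H\<^esub> = e \<one>\<^bsub>H\<^esub>"
  "x \<in> carrier H \<Longrightarrow> y \<in> carrier H \<Longrightarrow> nat_copy_dist H d (e x) (e y) = d x y"
  "x \<in> carrier H \<Longrightarrow> y \<in> carrier H \<Longrightarrow> e x = e y \<longleftrightarrow> x = y"
proof -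
  show "x \<in> carrier H \<Longrightarrow> y \<in> carrier H \<Longrightarrow> e x = e y \<longleftrightarrow> x = y"
    using inv_into_encode by metis
qed (simp_all add: nat_copy_def nat_copy_dist_def Let_def inv_into_encode flip: e_def)

lemma group_nat_copy:
  assumes "group H"
  shows "group (nat_copy H)"
proof -
  interpret group H by fact
  show ?thesis
  proof (rule groupI)
    fix a assume "a \<in> carrier (nat_copy H)"
    then obtain x where "x \<in> carrier H" "a = e x" by (auto simp: nat_copy_simps)
    then show "\<exists>b\<in>carrier (nat_copy H). b \<otimes>\<^bsub>nat_copy H\<^esub> a = \<one>\<^bsub>nat_copy H\<^esub>"
      by (intro bexI[of _ "e (inv\<^bsub>H\<^esub> x)"]) (auto simp: nat_copy_simps)
  qed (auto simp: nat_copy_simps m_assoc)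
qed

lemma biinv_metric_nat_copy:
  assumes "group H" and d: "biinv_metric H d"
  shows "biinv_metric (nat_copy H) (nat_copy_dist H d)"
proof -
  interpret group H by fact
  note d = biinv_metricD[OF d]
  show ?thesis
    unfolding biinv_metric_def nat_copy_simps(1) ball_simps
    by (auto simp: nat_copy_simps(2-) d(1,4,5,6) intro: d(2))
qed

end

text \<open>The ultrafilter contains the complement of every point, hence of every finite set, so
  whatever holds for all large k holds along it.\<close>

lemma nonprincipal_le_sequentially:
  assumes "nonprincipal_ultrafilter \<omega>"
  shows "\<omega> \<le> sequentially"
proof (rule filter_leI)
  fix P assume "eventually P sequentially"
  then obtain N where N: "\<And>k. N \<le> k \<Longrightarrow> P k" by (auto simp: eventually_sequentially)
  have "\<forall>\<^sub>F k in \<omega>. k \<noteq> n" for n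
    using assms unfolding nonprincipal_ultrafilter_def ultrafilter_def by blast
  then have "\<forall>\<^sub>F k in \<omega>. \<forall>n\<in>{..<N}. k \<noteq> n" by (intro eventually_ball_finite) auto
  then show "eventually P \<omega>" by (rule eventually_mono) (use N in \<open>force simp: not_less[symmetric]\<close>)
qed

section \<open>From the complex numbers to finite fields and finite groups\<close>

lemma metric_group_family_GL:
  "(\<And>k. field (F k)) \<Longrightarrow> metric_group_family (\<lambda>k. GL_grp (F k) (n k)) (\<lambda>k. d_rk (F k) (n k))"
  by (rule metric_group_family.intro) (simp_all add: field.group_GL_grp field.biinv_metric_d_rk)

text \<open>Only the first \<open>k\<close> elements of \<open>G\<close> are transferred to the \<open>k\<close>-th finite field: this
  involves finitely many complex numbers, and every element of \<open>G\<close> is treated for almost all \<open>k\<close>.\<close>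

lemma asymptotic_embedding_finite_fields:
  fixes G :: "('a, 'b) monoid_scheme"
  assumes G: "group G" and cG: "countable (carrier G)" and \<omega>: "\<omega> \<le> sequentially"
    and emb: "metric_group_family.asymptotic_embedding (\<lambda>k. GL_grp complex_field (n k))
      (\<lambda>k. d_rk complex_field (n k)) \<omega> G A"
  shows "\<exists>(F :: nat \<Rightarrow> nat ring) B. (\<forall>k. field (F k) \<and> finite (carrier (F k))) \<and>
    metric_group_family.asymptotic_embedding (\<lambda>k. GL_grp (F k) (n k)) (\<lambda>k. d_rk (F k) (n k)) \<omega> G B"
proof -
  interpret G: group G by fact
  interpret C: metric_group_family "\<lambda>k. GL_grp complex_field (n k)" "\<lambda>k. d_rk complex_field (n k)"
    by (intro metric_group_family_GL field_complex_field)
  have A: "A g k \<in> GL complex_field (n k)" if "g \<in> carrier G" for g k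
    using emb that by (simp add: C.asymptotic_embedding_def GL_grp_simps)
  define E where "E k = from_nat_into (carrier G) ` {..<k}" for k
  have E: "finite (E k)" "E k \<subseteq> carrier G" for k
    unfolding E_def using from_nat_into[of "carrier G"] G.one_closed by blast+
  have evE: "\<forall>\<^sub>F k in \<omega>. g \<in> E k" if g: "g \<in> carrier G" for g
  proof -
    obtain N where "from_nat_into (carrier G) N = g" using from_nat_into_surj[OF cG g] by blast
    then have "g \<in> E k" if "k \<ge> Suc N" for k using that unfolding E_def by force
    then have "\<forall>\<^sub>F k in sequentially. g \<in> E k" unfolding eventually_sequentially by blast
    then show ?thesis using \<omega> by (rule filter_leD[rotated])
  qed
  \<comment> \<open>The matrix of the product of g and h is reduced even if that product is outside
    E k; the set of requirements at stage k remains finite.\<close>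
  define good where "good k F \<phi> \<longleftrightarrow> (\<forall>g\<in>E k. map_mat \<phi> (A g k) \<in> GL F (n k)) \<and>
    (\<forall>g\<in>E k. \<forall>h\<in>E k. d_rk F (n k) (map_mat \<phi> (A g k)) (map_mat \<phi> (A h k)) =
        d_rk complex_field (n k) (A g k) (A h k)) \<and>
    (\<forall>g\<in>E k. \<forall>h\<in>E k. d_rk F (n k) (mat_mult F (n k) (map_mat \<phi> (A g k)) (map_mat \<phi> (A h k)))
        (map_mat \<phi> (A (g \<otimes>\<^bsub>G\<^esub> h) k)) =
      d_rk complex_field (n k) (mat_mult complex_field (n k) (A g k) (A h k)) (A (g \<otimes>\<^bsub>G\<^esub> h) k))"
    for k and F :: "nat ring" and \<phi>
  have "generically (good k)" for k
    unfolding good_def using E A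
    by (intro generically_conj generically_ball GL_transfer d_rk_transfer d_rk_mult_transfer) blast+
  then have "\<forall>k. \<exists>F \<phi>. field F \<and> finite (carrier F) \<and> good k F \<phi>"
    using generically_holds by blast
  then obtain F \<phi> where F: "\<And>k. field (F k)" "\<And>k. finite (carrier (F k))" and good: "\<And>k. good k (F k) (\<phi> k)"
    by metis
  interpret M: metric_group_family "\<lambda>k. GL_grp (F k) (n k)" "\<lambda>k. d_rk (F k) (n k)"
    by (intro metric_group_family_GL F(1))
  \<comment> \<open>The identity is a default that keeps B g k in the group at the early stages,
    where the reduction of A g k is not known to be invertible. Limits along \<omega> do not see
    these stages.\<close>
  define B where "B g k = (if g \<in> E k then map_mat (\<phi> k) (A g k) else mat_one (F k) (n k))" for g k
  have "M.asymptotic_embedding \<omega> G B"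
    unfolding M.asymptotic_embedding_def
  proof (intro conjI ballI allI impI)
    fix g k
    have "mat_one (F k) (n k) \<in> GL (F k) (n k)"
      using group.is_monoid[OF M.group_H[of k], THEN Group.monoid.one_closed] by (simp add: GL_grp_simps)
    then show "B g k \<in> carrier (GL_grp (F k) (n k))"
      using good[of k] by (simp add: B_def GL_grp_simps good_def)
  next
    fix g h assume gh: "g \<in> carrier G" "h \<in> carrier G"
    have lim: "((\<lambda>k. d_rk complex_field (n k) (mat_mult complex_field (n k) (A g k) (A h k))
        (A (g \<otimes>\<^bsub>G\<^esub> h) k)) \<longlongrightarrow> 0) \<omega>"
      using emb gh by (simp add: C.asymptotic_embedding_def GL_grp_simps)
    have "\<forall>\<^sub>F k in \<omega>. d_rk complex_field (n k) (mat_mult complex_field (n k) (A g k) (A h k)) (A (g \<otimes>\<^bsub>G\<^esub> h) k) =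
        d_rk (F k) (n k) (B g k \<otimes>\<^bsub>GL_grp (F k) (n k)\<^esub> B h k) (B (g \<otimes>\<^bsub>G\<^esub> h) k)"
      \<comment> \<open>The product must have entered E k too, so that B at the product is a reduced
        matrix and not the default.\<close>
      using evE[OF gh(1)] evE[OF gh(2)] evE[OF G.m_closed[OF gh]]
    proof eventually_elim
      case (elim k)
      then show ?case using good[of k] by (simp add: B_def GL_grp_simps good_def)
    qed
    from tendsto_cong[OF this] lim
    show "((\<lambda>k. d_rk (F k) (n k) (B g k \<otimes>\<^bsub>GL_grp (F k) (n k)\<^esub> B h k) (B (g \<otimes>\<^bsub>G\<^esub> h) k)) \<longlongrightarrow> 0) \<omega>"
      by blast
  next
    fix g h assume gh: "g \<in> carrier G" "h \<in> carrier G"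
      and lim: "((\<lambda>k. d_rk (F k) (n k) (B g k) (B h k)) \<longlongrightarrow> 0) \<omega>"
    have "\<forall>\<^sub>F k in \<omega>. d_rk (F k) (n k) (B g k) (B h k) = d_rk complex_field (n k) (A g k) (A h k)"
      using evE[OF gh(1)] evE[OF gh(2)]
    proof eventually_elim
      case (elim k)
      then show ?case using good[of k] by (simp add: B_def good_def)
    qed
    from tendsto_cong[OF this] lim
    have "((\<lambda>k. d_rk complex_field (n k) (A g k) (A h k)) \<longlongrightarrow> 0) \<omega>" by blast
    then show "g = h" using emb gh unfolding C.asymptotic_embedding_def by blast
  qed
  then show ?thesis using F by (intro exI[of _ F] exI[of _ B]) simp
qed

text \<open>Numbering the elements of each finite group preserves products and distances, so the
  same representatives, renamed, form an asymptotic embedding into groups of natural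
  numbers.\<close>

lemma weakly_soficI:
  fixes G :: "('a, 'b) monoid_scheme"
  assumes G: "group G" and \<omega>: "nonprincipal_ultrafilter \<omega>" and "metric_group_family H d"
    and fin: "\<And>k. finite (carrier (H k))"
    and emb: "metric_group_family.asymptotic_embedding H d \<omega> G B"
  shows "weakly_sofic G"
proof -
  interpret G: group G by fact
  interpret H: metric_group_family H d by fact
  define e where "e k = to_nat_on (carrier (H k))" for k
  define N where "N k = nat_copy (H k)" for k
  define D where "D k = nat_copy_dist (H k) (d k)" for k
  have c: "countable (carrier (H k))" for k using fin by (rule countable_finite)
  note N = nat_copy_simps[OF c, folded e_def N_def]
  have D: "D k (e k x) (e k y) = d k x y" if "x \<in> carrier (H k)" "y \<in> carrier (H k)" for k x y
    using nat_copy_simps(4)[OF c that] by (simp add: D_def e_def)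
  interpret N: metric_group_family N D
    unfolding N_def D_def
    by (rule metric_group_family.intro) (intro group_nat_copy biinv_metric_nat_copy c H.group_H H.biinv)+
  have B: "B g k \<in> carrier (H k)" if "g \<in> carrier G" for g k
    using emb that by (simp add: H.asymptotic_embedding_def)
  have Bm: "B g k \<otimes>\<^bsub>H k\<^esub> B h k \<in> carrier (H k)" if "g \<in> carrier G" "h \<in> carrier G" for g h k
    using B that group.is_monoid[OF H.group_H] Group.monoid.m_closed by metis
  have "N.asymptotic_embedding \<omega> G (\<lambda>g k. e k (B g k))"
    using emb B Bm unfolding N.asymptotic_embedding_def H.asymptotic_embedding_def
    by (simp add: N D)
  then have "\<exists>\<Phi>. \<Phi> \<in> hom G (metric_ultraproduct \<omega> N D) \<and> inj_on \<Phi> (carrier G)"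
    using N.embeds_in_metric_ultraproduct_iff[OF G] by blast
  moreover have "group (N k) \<and> finite (carrier (N k)) \<and> biinv_metric (N k) (D k)" for k
    using N.group_H N.biinv fin by (simp add: N(1))
  ultimately show ?thesis unfolding weakly_sofic_def using \<omega> by blast
qed

theorem mainTheorem3:
  fixes G :: "('a, 'b) monoid_scheme"
  assumes "group G" and "countable (carrier G)" and "linear_sofic G"
  shows "(\<exists>\<omega> (n :: nat \<Rightarrow> nat) (F :: nat \<Rightarrow> nat ring).
            nonprincipal_ultrafilter \<omega> \<and> filterlim n at_top sequentially \<and>
            (\<forall>k. field (F k) \<and> finite (carrier (F k))) \<and>
            (\<exists>\<Phi>. \<Phi> \<in> hom G (metric_ultraproduct \<omega> (\<lambda>k. GL_grp (F k) (n k)) (\<lambda>k. d_rk (F k) (n k)))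
                 \<and> inj_on \<Phi> (carrier G)))
         \<and> weakly_sofic G"
proof -
  obtain \<omega> and n :: "nat \<Rightarrow> nat" where \<omega>: "nonprincipal_ultrafilter \<omega>" and n: "filterlim n at_top sequentially"
    and emb: "\<exists>\<Phi>. \<Phi> \<in> hom G (metric_ultraproduct \<omega> (\<lambda>k. GL_grp complex_field (n k)) (\<lambda>k. d_rk complex_field (n k)))
      \<and> inj_on \<Phi> (carrier G)"
    using assms(3) unfolding linear_sofic_def by blast
  interpret C: metric_group_family "\<lambda>k. GL_grp complex_field (n k)" "\<lambda>k. d_rk complex_field (n k)"
    by (intro metric_group_family_GL field_complex_field)
  obtain A where "C.asymptotic_embedding \<omega> G A"
    using C.embeds_in_metric_ultraproduct_iff[OF assms(1)] emb by blast
  from asymptotic_embedding_finite_fields[OF assms(1,2) nonprincipal_le_sequentially[OF \<omega>] this]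
  obtain F :: "nat \<Rightarrow> nat ring" and B where F: "\<forall>k. field (F k) \<and> finite (carrier (F k))"
    and B: "metric_group_family.asymptotic_embedding (\<lambda>k. GL_grp (F k) (n k)) (\<lambda>k. d_rk (F k) (n k)) \<omega> G B"
    by blast
  interpret M: metric_group_family "\<lambda>k. GL_grp (F k) (n k)" "\<lambda>k. d_rk (F k) (n k)"
    using F by (intro metric_group_family_GL) blast
  have "\<exists>\<Phi>. \<Phi> \<in> hom G (metric_ultraproduct \<omega> (\<lambda>k. GL_grp (F k) (n k)) (\<lambda>k. d_rk (F k) (n k)))
      \<and> inj_on \<Phi> (carrier G)"
    using M.embeds_in_metric_ultraproduct_iff[OF assms(1)] B by blast
  moreover have "weakly_sofic G"
    by (rule weakly_soficI[OF assms(1) \<omega> M.metric_group_family_axioms _ B])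
      (use F in \<open>simp add: GL_grp_simps finite_GL\<close>)
  ultimately show ?thesis using \<omega> n F by blast
qed

end
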